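(* Suppose that $\int\psi(\|\bm{x}\|)\,P(d\bm{x})<\infty$ and that $m_j(P)>m_k(P)$ for $j=1,\dots,k-1$. Then $\Theta'\neq\emptyset$, $$\lim_{n\to\infty} d(\hat\theta_n,\Theta')=0\quad\text{a.s.},\qquad\text{and}\qquad \lim_{n\to\infty} m_k(P_n)=m_k(P)\quad\text{a.s.}$$
   Context: Let $p,q,k$ be positive integers with $q<p$. $\|\cdot\|$ is the Euclidean norm. $\bm{X}_1,\bm{X}_2,\dots$ are i.i.d. $\mathbb{R}^p$-valued random variables with distribution $P$ (a Borel probability measure on $\mathbb{R}^p$), defined on a common probability space; $P_n$ is the empirical measure of $\bm{X}_1,\dots,\bm{X}_n$; "a.s." refers to the underlying probability space. $\psi:\mathbb{R}\to\mathbb{R}$ is a non-negative, non-decreasing, continuous function with $\psi(0)=0$, and there exists $\lambda>0$ such that $\psi(2r)\le\lambda\psi(r)$ for all $r>0$. (Factorial $k$-means clustering is the case $\psi(r)=r^2$ for $r\ge 0$.) $\mathcal{O}(p\times q)$ is the set of real $p\times q$ matrices $A$ with $A^TA=I_q$. For each positive integer $j$, $\mathcal{R}_j$ is the set of nonempty subsets of $\mathbb{R}^q$ with at most $j$ elements, and $\Xi_j:=\mathcal{R}_j\times\mathcal{O}(p\times q)$. For a probability measure $Q$ on $\mathbb{R}^p$, nonempty finite $F\subset\mathbb{R}^q$ and $A\in\mathcal{O}(p\times q)$, set $$\Psi(F,A,Q):=\int\min_{\bm{f}\in F}\psi(\|A^T\bm{x}-\bm{f}\|)\,Q(d\bm{x}),\qquad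 m_j(Q):=\inf_{(F,A)\in\Xi_j}\Psi(F,A,Q).$$ Write $\Psi(\theta,Q)=\Psi(F,A,Q)$ for $\theta=(F,A)$. $\Theta':=\{\theta\in\Xi_k: \Psi(\theta,P)=m_k(P)\}$ and $\Theta'_n:=\{\theta\in\Xi_k:\Psi(\theta,P_n)=m_k(P_n)\}$. For each $n$, $\hat\theta_n$ is a measurable estimator with $\hat\theta_n\in\Theta'_n$. $d:=\sqrt{d_F^2+d_H^2}$ is the product distance on $\Xi_k$, where $d_F$ is the Frobenius distance between matrices and $d_H$ is the Hausdorff distance between nonempty finite subsets of $\mathbb{R}^q$: $d_H(E,G)=\max\{\max_{\bm{a}\in E}\min_{\bm{b}\in G}\|\bm{a}-\bm{b}\|,\ \max_{\bm{b}\in G}\min_{\bm{a}\in E}\|\bm{a}-\bm{b}\|\}$. For $\theta_0\in\Xi_k$, $d(\theta_0,\Theta'):=\inf\{d(\theta_0,\theta):\theta\in\Theta'\}$. *)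

theory Defs
  imports "HOL-Probability.Probability"
begin

text \<open>
  \<open>\<real>\<^sup>p\<close> and \<open>\<real>\<^sup>q\<close> are \<^typ>\<open>real^'p\<close> and \<^typ>\<open>real^'q\<close>, so that \<open>p = CARD('p)\<close>, \<open>q = CARD('q)\<close>;
  a \<open>p \<times> q\<close> matrix has type \<^typ>\<open>real^'q^'p\<close>.
\<close>

type_synonym ('q, 'p) param = "(real^'q) set \<times> (real^'q^'p)"

definition orthonormal_matrices :: "(real^'q^'p) set" where
  "orthonormal_matrices = {A. transpose A ** A = mat 1}"

definition center_sets :: "nat \<Rightarrow> (real^'q) set set" where
  "center_sets j = {F. finite F \<and> F \<noteq> {} \<and> card F \<le> j}"

definition Xi :: "nat \<Rightarrow> ('q::finite, 'p::finite) param set" where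
  "Xi j = center_sets j \<times> orthonormal_matrices"

text \<open>
  The integral is that of a non-negative function and may be infinite, hence it is valued in
  \<^typ>\<open>ennreal\<close>.
\<close>

definition Psi ::
  "(real \<Rightarrow> real) \<Rightarrow> ('q::finite, 'p::finite) param \<Rightarrow> (real^'p) measure \<Rightarrow> ennreal" where
  "Psi \<psi> \<theta> Q =
     (\<integral>\<^sup>+ x. ennreal (Min ((\<lambda>f. \<psi> (norm (transpose (snd \<theta>) *v x - f))) ` fst \<theta>)) \<partial>Q)"

text \<open>The type token fixes \<open>q\<close>, which the type of \<open>Q\<close> does not determine.\<close>

definition min_risk ::
  "'q::finite itself \<Rightarrow> (real \<Rightarrow> real) \<Rightarrow> nat \<Rightarrow> (real^'p) measure \<Rightarrow> ennreal" where
  "min_risk q \<psi> j Q = (INF \<theta>\<in>(Xi j :: ('q::finite, 'p::finite) param set). Psi \<psi> \<theta> Q)"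

definition optimal_params ::
  "(real \<Rightarrow> real) \<Rightarrow> nat \<Rightarrow> (real^'p) measure \<Rightarrow> ('q::finite, 'p::finite) param set" where
  "optimal_params \<psi> k Q = {\<theta> \<in> Xi k. Psi \<psi> \<theta> Q = min_risk TYPE('q) \<psi> k Q}"

text \<open>The sample is indexed from \<open>0\<close>: the first \<open>n\<close> observations are \<open>x 0, \<dots>, x (n - 1)\<close>.\<close>

definition empirical_measure :: "nat \<Rightarrow> (nat \<Rightarrow> real^'p) \<Rightarrow> (real^'p) measure" where
  "empirical_measure n x = distr (uniform_count_measure {..<n}) borel x"

definition hausdorff_dist :: "'a::metric_space set \<Rightarrow> 'a set \<Rightarrow> real" where
  "hausdorff_dist E G =
     max (Max ((\<lambda>a. Min ((\<lambda>b. dist a b) ` G)) ` E)) (Max ((\<lambda>b. Min ((\<lambda>a. dist a b) ` E)) ` G))"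

text \<open>On matrices, \<^const>\<open>dist\<close> is the Frobenius distance:\<close>

lemma dist_matrix_eq_Frobenius:
  fixes A B :: "real^'q^'p"
  shows "dist A B = sqrt (\<Sum>i\<in>UNIV. \<Sum>j\<in>UNIV. (A $ i $ j - B $ i $ j)\<^sup>2)"
  by (simp add: dist_vec_def L2_set_def dist_real_def sum_nonneg)

definition param_dist ::
  "('q::finite, 'p::finite) param \<Rightarrow> ('q, 'p) param \<Rightarrow> real" where
  "param_dist = prod_dist hausdorff_dist dist"

lemma param_dist_eq:
  "param_dist (E, A) (G, B) = sqrt ((dist A B)\<^sup>2 + (hausdorff_dist E G)\<^sup>2)"
  by (simp add: param_dist_def prod_dist_def add.commute)

definition param_setdist ::
  "('q::finite, 'p::finite) param \<Rightarrow> ('q, 'p) param set \<Rightarrow> real" where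
  "param_setdist \<theta>\<^sub>0 T = (INF \<theta>\<in>T. param_dist \<theta>\<^sub>0 \<theta>)"

lemma hausdorff_dist_commute: "hausdorff_dist E G = hausdorff_dist G E"
  by (simp add: hausdorff_dist_def dist_commute max.commute)

lemma hausdorff_dist_le_iff:
  assumes "finite E" "E \<noteq> {}" "finite G" "G \<noteq> {}"
  shows "hausdorff_dist E G \<le> r \<longleftrightarrow>
    (\<forall>a\<in>E. \<exists>b\<in>G. dist a b \<le> r) \<and> (\<forall>b\<in>G. \<exists>a\<in>E. dist a b \<le> r)"
  using assms by (auto simp: hausdorff_dist_def Min_le_iff)

text \<open>
  The absolute value covers infinite arguments, where \<^const>\<open>Max\<close> is unspecified;
  \<^const>\<open>param_dist\<close> only uses squares.
\<close>

lemma Metric_space_hausdorff_dist: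
  "Metric_space {F :: 'a::metric_space set. finite F \<and> F \<noteq> {}} (\<lambda>E G. \<bar>hausdorff_dist E G\<bar>)"
proof -
  have nonneg: "0 \<le> hausdorff_dist E G"
    if fin: "finite E" "E \<noteq> {}" "finite G" "G \<noteq> {}" for E G :: "'a set"
  proof -
    obtain a where "a \<in> E" using fin by blast
    then obtain b where "dist a b \<le> hausdorff_dist E G"
      using hausdorff_dist_le_iff[OF fin, of "hausdorff_dist E G"] by auto
    then show ?thesis using zero_le_dist[of a b] by linarith
  qed
  have zero: "hausdorff_dist E G = 0 \<longleftrightarrow> E = G"
    if fin: "finite E" "E \<noteq> {}" "finite G" "G \<noteq> {}" for E G :: "'a set"
    using nonneg[OF fin] hausdorff_dist_le_iff[OF fin, of 0] by (auto intro: antisym)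
  have triangle: "hausdorff_dist E H \<le> hausdorff_dist E G + hausdorff_dist G H"
    if fin: "finite E" "E \<noteq> {}" "finite G" "G \<noteq> {}" "finite H" "H \<noteq> {}" for E G H :: "'a set"
  proof -
    note EG = hausdorff_dist_le_iff[OF fin(1-4), of "hausdorff_dist E G"]
    note GH = hausdorff_dist_le_iff[OF fin(3-6), of "hausdorff_dist G H"]
    show ?thesis
      unfolding hausdorff_dist_le_iff[OF fin(1,2,5,6)]
      using EG GH by (meson add_mono dist_triangle order_refl order_trans)
  qed
  show ?thesis
    by unfold_locales (use nonneg zero triangle in \<open>auto simp: hausdorff_dist_commute\<close>)
qed

lemma Metric_space_param_dist:
  "Metric_space (Xi k) (param_dist :: ('q::finite, 'p::finite) param \<Rightarrow> _)"
proof -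
  interpret Metric_space12 "{F :: (real^'q) set. finite F \<and> F \<noteq> {}}"
      "\<lambda>E G. \<bar>hausdorff_dist E G\<bar>" "UNIV :: (real^'q^'p) set" dist
    by (simp add: Metric_space12_def Metric_space_hausdorff_dist Met_TC.Metric_space_axioms)
  have "param_dist = (prod_dist (\<lambda>E G. \<bar>hausdorff_dist E G\<bar>) dist :: ('q::finite, 'p::finite) param \<Rightarrow> _)"
    by (simp add: param_dist_def prod_dist_def)
  then show ?thesis
    by (metis (no_types, lifting) Prod_metric.subspace Xi_def center_sets_def Sigma_mono
        Collect_mono subset_UNIV)
qed

definition Xi_borel :: "nat \<Rightarrow> ('q::finite, 'p::finite) param measure" where
  "Xi_borel k = sigma (Xi k) {U. openin (Metric_space.mtopology (Xi k) param_dist) U}"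

end

theory Submission
  imports Defs
begin

text \<open>
  The integrands \<open>x \<mapsto> min T (min\<^sub>f \<psi> \<parallel>A\<^sup>Tx - f\<parallel>)\<close>, taken over all parameters in \<open>\<Xi>\<^sub>k\<close> at once, are
  bounded and uniformly equicontinuous: \<open>\<psi>\<close> truncated at \<open>T\<close> is uniformly continuous, and \<open>A\<^sup>T\<close> does
  not increase norms. Convergence of the empirical measures on countable partitions into small cells
  therefore gives a uniform lower bound on truncated empirical risks by truncated risks under \<open>P\<close>,
  without any a priori bound on the estimated centres. Along a subsequence, the matrices converge and
  each centre either converges or escapes to infinity; by Fatou, the limit of the convergent centres
  has risk at most the limiting empirical risk, which by the strong law at one optimal parameter is at
  most \<open>m\<^sub>k(P)\<close>. As \<open>m\<^sub>j(P) > m\<^sub>k(P)\<close> for \<open>j < k\<close>, no centre can have been lost, so the subsequence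
  converges to a point of \<open>\<Theta>'\<close>.

  The upper half of the strong law rests on Hoeffding's inequality for truncated variables and on the
  maximal ergodic inequality for the tails.
\<close>

subsection \<open>Strong laws for i.i.d. sequences\<close>

text \<open>Independence concerns finite index sets only: the product formula over \<open>J\<close>
  for the shifted family is that of the original family over the image of \<open>J\<close> under
  \<open>Suc\<close>. This identifies the joint law of the shifted sequence in Garsia's
  argument.\<close>

lemma (in prob_space) indep_vars_Suc:
  fixes Y :: "nat \<Rightarrow> 'a \<Rightarrow> 'b"
  assumes "indep_vars (\<lambda>_. N) Y UNIV"
  shows "indep_vars (\<lambda>_. N) (\<lambda>i. Y (Suc i)) UNIV"
proof -
  define F where "F = (\<lambda>i. {Y i -` A \<inter> space M | A. A \<in> sets N})"
  have rv: "random_variable N (Y i)" for i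
    using assms by (simp add: indep_vars_def2)
  have F: "indep_sets F UNIV"
    using assms by (simp add: indep_vars_def2 F_def)
  have "indep_sets (\<lambda>i. F (Suc i)) UNIV"
  proof (rule indep_setsI)
    show "F (Suc i) \<subseteq> events" for i
      using F by (auto simp: indep_sets_def)
    fix A J assume J: "J \<noteq> {}" "J \<subseteq> UNIV" "finite J" and A: "\<forall>j\<in>J. A j \<in> F (Suc j)"
    have "prob (\<Inter>j\<in>Suc ` J. A (j - 1)) = (\<Prod>j\<in>Suc ` J. prob (A (j - 1)))"
      using J A by (intro indep_setsD[OF F]) auto
    then show "prob (\<Inter>j\<in>J. A j) = (\<Prod>j\<in>J. prob (A j))"
      by (simp add: prod.reindex)
  qed
  with rv show ?thesis
    by (simp add: indep_vars_def2 F_def)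
qed

text \<open>Hoeffding's inequality makes the probabilities of deviations by \<epsilon> decay
  geometrically, so they are summable and the Borel-Cantelli lemma applies.\<close>

lemma (in prob_space) strong_law_bounded:
  fixes Y :: "nat \<Rightarrow> 'a \<Rightarrow> real"
  assumes indep: "indep_vars (\<lambda>_. borel) Y UNIV"
    and distr: "\<And>i. distr M borel (Y i) = distr M borel (Y 0)"
    and bounds: "\<And>i \<omega>. \<omega> \<in> space M \<Longrightarrow> Y i \<omega> \<in> {0..b}"
  shows "AE \<omega> in M. (\<lambda>n. (\<Sum>i<n. Y i \<omega>) / n) \<longlonglongrightarrow> expectation (Y 0)"
proof -
  define \<mu> where "\<mu> = expectation (Y 0)"
  have rv [measurable]: "random_variable borel (Y i)" for i
    using indep by (simp add: indep_vars_def2)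
  obtain \<omega> where "\<omega> \<in> space M" using not_empty by blast
  from bounds[OF this, of 0] have b: "0 < b + 1" by auto
  have "AE \<omega> in M. eventually (\<lambda>n. \<bar>(\<Sum>i<n. Y i \<omega>) / n - \<mu>\<bar> < \<epsilon>) sequentially"
    if \<epsilon>: "\<epsilon> > 0" for \<epsilon>
  proof -
    define A where "A = (\<lambda>n. {\<omega> \<in> space M. \<bar>(\<Sum>i<n. Y i \<omega>) / n - \<mu>\<bar> \<ge> \<epsilon>})"
    \<comment> \<open>\<open>2 * q ^ n\<close> is the Hoeffding bound for \<open>n\<close> terms.
      The range is widened to \<open>{0..b + 1}\<close> so that its length is positive even for
      \<open>b = 0\<close>.\<close>
    define q where "q = exp (- 2 * \<epsilon>\<^sup>2 / (b + 1)\<^sup>2)"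
    have A [measurable]: "A n \<in> events" for n
      unfolding A_def by measurable
    have "prob (A n) \<le> 2 * q ^ n" for n
    proof (cases "n = 0")
      case False
      interpret Hoeffding_ineq_iid M "{..<n}" Y "Y 0" 0 "b + 1" \<mu>
      proof unfold_locales
        show "AE x in M. Y 0 x \<in> {0..b + 1}"
          using bounds[of _ 0] by (intro AE_I2) (fastforce)
      qed (use distr indep in \<open>auto simp: \<mu>_def intro: indep_vars_subset\<close>)
      have "q ^ n = exp (- 2 * n * \<epsilon>\<^sup>2 / (b + 1)\<^sup>2)"
        unfolding q_def by (simp flip: exp_of_nat_mult)
      with Hoeffding_ineq_abs_ge'[of \<epsilon>] \<epsilon> b False show ?thesis
        by (auto simp: A_def)
    qed (use prob_le_1[of "A 0"] in \<open>auto intro: order_trans\<close>)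
    moreover have "\<bar>q\<bar> < 1"
      using \<epsilon> b unfolding q_def by (auto simp: divide_neg_pos)
    then have "summable (\<lambda>n. 2 * q ^ n)"
      by (intro summable_mult summable_geometric) simp
    ultimately have "summable (\<lambda>n. prob (A n))"
      by (intro summable_comparison_test[of "\<lambda>n. prob (A n)" "\<lambda>n. 2 * q ^ n"]) auto
    then have "AE \<omega> in M. eventually (\<lambda>n. \<omega> \<in> space M - A n) sequentially"
      by (intro borel_cantelli_AE1) (auto simp: less_top[symmetric])
    then show ?thesis
      by eventually_elim (auto elim!: eventually_mono simp: A_def)
  qed
  \<comment> \<open>Countably many tolerances suffice, so the exceptional null sets can be
    united.\<close>
  then have "AE \<omega> in M. \<forall>m. eventually (\<lambda>n. \<bar>(\<Sum>i<n. Y i \<omega>) / n - \<mu>\<bar> < inverse (Suc m)) sequentially"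
    by (auto simp: AE_all_countable)
  then show ?thesis
  proof eventually_elim
    case (elim \<omega>)
    show ?case
      unfolding tendsto_iff \<mu>_def[symmetric] dist_real_def
    proof (intro allI impI)
      fix e :: real assume "e > 0"
      then obtain m where "inverse (Suc m) < e" using reals_Archimedean by blast
      with elim[rule_format, of m] show "\<forall>\<^sub>F n in sequentially. \<bar>(\<Sum>i<n. Y i \<omega>) / real n - \<mu>\<bar> < e"
        by (auto elim!: eventually_mono)
    qed
  qed
qed

section \<open>Maximal inequality for partial sums of i.i.d. variables\<close>

text \<open>This is the maximum of the sums of the first \<open>n\<close> terms for
  \<open>n \<le> N\<close>, the empty sum included. The recursion splits off the first term, which
  is the form that comparison with the shifted sequence requires.\<close>

primrec max_partial_sum :: "nat \<Rightarrow> (nat \<Rightarrow> real) \<Rightarrow> real" where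
  "max_partial_sum 0 d = 0"
| "max_partial_sum (Suc N) d = max 0 (d 0 + max_partial_sum N (\<lambda>i. d (Suc i)))"

lemma max_partial_sum_nonneg: "0 \<le> max_partial_sum N d"
  by (cases N) auto

lemma sum_le_max_partial_sum: "n \<le> N \<Longrightarrow> (\<Sum>i<n. d i) \<le> max_partial_sum N d"
proof (induction N arbitrary: n d)
  case (Suc N)
  show ?case
  proof (cases n)
    case (Suc n')
    then show ?thesis
      using Suc.IH[of n' "\<lambda>i. d (Suc i)"] Suc.prems by (simp add: sum.lessThan_Suc_shift del: sum.lessThan_Suc)
  qed (simp add: max_partial_sum_nonneg)
qed simp

lemma max_partial_sum_le_Suc: "max_partial_sum N d \<le> max_partial_sum (Suc N) d"
proof (induction N arbitrary: d)
  case (Suc N)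
  from Suc.IH[of "\<lambda>i. d (Suc i)"] show ?case by simp
qed simp

lemma max_partial_sum_le_sum_abs: "max_partial_sum N d \<le> (\<Sum>i<N. \<bar>d i\<bar>)"
proof (induction N arbitrary: d)
  case (Suc N)
  from Suc.IH[of "\<lambda>i. d (Suc i)"] show ?case
    by (simp add: sum.lessThan_Suc_shift sum_nonneg del: sum.lessThan_Suc)
qed simp

lemma measurable_max_partial_sum [measurable]:
  "max_partial_sum N \<in> borel_measurable (\<Pi>\<^sub>M i\<in>UNIV. borel)"
proof (induction N)
  case (Suc N)
  have "(\<lambda>d i. d (Suc i)) \<in> (\<Pi>\<^sub>M i\<in>UNIV. borel) \<rightarrow>\<^sub>M (\<Pi>\<^sub>M i\<in>(UNIV::nat set). (borel :: real measure))"
    by (rule measurable_PiM_single') (auto intro: measurable_component_singleton)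
  from measurable_compose[OF this Suc.IH] have "(\<lambda>d. max_partial_sum N (\<lambda>i. d (Suc i))) \<in> borel_measurable (\<Pi>\<^sub>M i\<in>UNIV. borel)" .
  moreover have "(\<lambda>d. d 0) \<in> borel_measurable (\<Pi>\<^sub>M i\<in>(UNIV::nat set). (borel :: real measure))"
    by (rule measurable_component_singleton) simp
  ultimately show ?case
    by (simp add: borel_measurable_max borel_measurable_add)
qed simp

text \<open>
  Garsia's argument: on the event that the maximal partial sum \<open>S\<close> over \<open>N + 1\<close> terms is positive,
  \<open>S\<close> exceeds the maximal sum of the shifted sequence by exactly \<open>D 0\<close>, and the shift does not change
  expectations.
\<close>

lemma (in prob_space) maximal_ergodic_iid:
  fixes D :: "nat \<Rightarrow> 'a \<Rightarrow> real"
  assumes indep: "indep_vars (\<lambda>_. borel) D UNIV"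
    and distr: "\<And>i. distr M borel (D i) = distr M borel (D 0)"
    and int: "integrable M (D 0)"
  shows "0 \<le> (\<integral>\<omega>. indicator {\<omega> \<in> space M. 0 < max_partial_sum (Suc N) (\<lambda>i. D i \<omega>)} \<omega> * D 0 \<omega> \<partial>M)"
proof -
  have rv [measurable]: "random_variable borel (D i)" for i
    using indep by (simp add: indep_vars_def2)
  have int': "integrable M (D i)" for i
    using int integrable_distr_eq[OF rv[of i], of "\<lambda>x. x"] integrable_distr_eq[OF rv[of 0], of "\<lambda>x. x"] distr[of i]
    by simp
  let ?S = "\<lambda>n \<omega>. max_partial_sum n (\<lambda>i. D i \<omega>)" and ?S' = "\<lambda>n \<omega>. max_partial_sum n (\<lambda>i. D (Suc i) \<omega>)"
  have [measurable]: "(\<lambda>\<omega> i. D i \<omega>) \<in> M \<rightarrow>\<^sub>M (\<Pi>\<^sub>M i\<in>UNIV. borel)"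
      "(\<lambda>\<omega> i. D (Suc i) \<omega>) \<in> M \<rightarrow>\<^sub>M (\<Pi>\<^sub>M i\<in>UNIV. borel)"
    by (rule measurable_PiM_single'; auto)+
  have S [measurable]: "random_variable borel (?S n)" "random_variable borel (?S' n)" for n
    by measurable
  have int_S: "integrable M (?S n)" for n
    by (rule Bochner_Integration.integrable_bound[of _ "\<lambda>\<omega>. \<Sum>i<n. \<bar>D i \<omega>\<bar>"])
      (use int' max_partial_sum_nonneg max_partial_sum_le_sum_abs in \<open>auto intro!: AE_I2 order_trans[OF _ abs_ge_self]\<close>)
  have int_S': "integrable M (?S' n)" for n
    by (rule Bochner_Integration.integrable_bound[of _ "\<lambda>\<omega>. \<Sum>i<n. \<bar>D (Suc i) \<omega>\<bar>"])
      (use int' max_partial_sum_nonneg max_partial_sum_le_sum_abs in \<open>auto intro!: AE_I2 order_trans[OF _ abs_ge_self]\<close>)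
  \<comment> \<open>By independence both joint laws are product measures, and their factors agree
    because the variables are identically distributed.\<close>
  have "distr M (\<Pi>\<^sub>M i\<in>UNIV. borel) (\<lambda>\<omega> i. D i \<omega>) = (\<Pi>\<^sub>M i\<in>UNIV. distr M borel (D i))"
    using indep indep_vars_iff_distr_eq_PiM[where I = UNIV and M' = "\<lambda>_. borel" and X = D] by (simp add: restrict_UNIV)
  moreover have "distr M (\<Pi>\<^sub>M i\<in>UNIV. borel) (\<lambda>\<omega> i. D (Suc i) \<omega>) = (\<Pi>\<^sub>M i\<in>UNIV. distr M borel (D (Suc i)))"
    using indep_vars_Suc[OF indep] indep_vars_iff_distr_eq_PiM[where I = UNIV and M' = "\<lambda>_. borel" and X = "\<lambda>i. D (Suc i)"]
    by (simp add: restrict_UNIV)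
  moreover have "(\<lambda>i. distr M borel (D i)) = (\<lambda>i. distr M borel (D (Suc i)))"
    using distr by metis
  ultimately have joint: "distr M (\<Pi>\<^sub>M i\<in>UNIV. borel) (\<lambda>\<omega> i. D i \<omega>) = distr M (\<Pi>\<^sub>M i\<in>UNIV. borel) (\<lambda>\<omega> i. D (Suc i) \<omega>)"
    by simp
  have "expectation (?S N) = (\<integral>d. max_partial_sum N d \<partial>distr M (\<Pi>\<^sub>M i\<in>UNIV. borel) (\<lambda>\<omega> i. D i \<omega>))"
    by (subst integral_distr) auto
  also have "\<dots> = expectation (?S' N)"
    unfolding joint by (subst integral_distr) auto
  \<comment> \<open>\<open>?S' N\<close> has the same expectation as \<open>?S N\<close>, which is
    at most \<open>?S (Suc N)\<close> pointwise.\<close>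
  finally have "0 \<le> expectation (?S (Suc N)) - expectation (?S' N)"
    using integral_mono[OF int_S int_S, of N "Suc N"] max_partial_sum_le_Suc by fastforce
  also have "\<dots> = (\<integral>\<omega>. ?S (Suc N) \<omega> - ?S' N \<omega> \<partial>M)"
    using int_S int_S' by (rule Bochner_Integration.integral_diff[symmetric])
  also have "\<dots> \<le> (\<integral>\<omega>. indicator {\<omega> \<in> space M. 0 < ?S (Suc N) \<omega>} \<omega> * D 0 \<omega> \<partial>M)"
  proof (rule integral_mono)
    show "integrable M (\<lambda>\<omega>. indicator {\<omega> \<in> space M. 0 < ?S (Suc N) \<omega>} \<omega> * D 0 \<omega>)"
      by (rule Bochner_Integration.integrable_bound[OF int]) (auto intro!: AE_I2 split: split_indicator)
    \<comment> \<open>Off the event, \<open>?S (Suc N)\<close> is 0 and the left side is minus a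
      non-negative number.\<close>
    show "?S (Suc N) \<omega> - ?S' N \<omega> \<le> indicator {\<omega> \<in> space M. 0 < ?S (Suc N) \<omega>} \<omega> * D 0 \<omega>"
      if "\<omega> \<in> space M" for \<omega>
      using that max_partial_sum_nonneg[of N "\<lambda>i. D (Suc i) \<omega>"] by (auto split: split_indicator)
  qed (use int_S int_S' in \<open>auto simp del: max_partial_sum.simps\<close>)
  finally show ?thesis .
qed

text \<open>The maximal ergodic inequality is applied to \<open>Y i - a\<close>. The events that one
  of the first \<open>N + 1\<close> partial sums of this sequence is positive increase with
  \<open>N\<close>, and their union contains the event in question.\<close>

lemma (in prob_space) maximal_inequality_iid:
  fixes Y :: "nat \<Rightarrow> 'a \<Rightarrow> real"
  assumes indep: "indep_vars (\<lambda>_. borel) Y UNIV"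
    and distr: "\<And>i. distr M borel (Y i) = distr M borel (Y 0)"
    and int: "integrable M (Y 0)" and nonneg: "\<And>\<omega>. \<omega> \<in> space M \<Longrightarrow> 0 \<le> Y 0 \<omega>"
    and a: "a > 0"
  shows "a * prob {\<omega> \<in> space M. \<exists>n. (\<Sum>i<n. Y i \<omega>) > n * a} \<le> expectation (Y 0)"
proof -
  have rv [measurable]: "random_variable borel (Y i)" for i
    using indep by (simp add: indep_vars_def2)
  let ?D = "\<lambda>i \<omega>. Y i \<omega> - a"
  define E where "E = (\<lambda>N. {\<omega> \<in> space M. 0 < max_partial_sum (Suc N) (\<lambda>i. ?D i \<omega>)})"
  have [measurable]: "(\<lambda>\<omega> i. ?D i \<omega>) \<in> M \<rightarrow>\<^sub>M (\<Pi>\<^sub>M i\<in>UNIV. borel)"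
    by (rule measurable_PiM_single'; auto)
  have E [measurable]: "E N \<in> events" for N
    unfolding E_def by (measurable)
  have bound: "a * prob (E N) \<le> expectation (Y 0)" for N
  proof -
    have D_distr: "distr M borel (?D i) = distr M borel (?D 0)" for i
    proof -
      have "distr M borel (?D i) = distr (distr M borel (Y i)) borel (\<lambda>y. y - a)" for i
        by (subst distr_distr) (auto simp: comp_def)
      with distr show ?thesis by metis
    qed
    have "0 \<le> (\<integral>\<omega>. indicator (E N) \<omega> * ?D 0 \<omega> \<partial>M)"
      unfolding E_def
      by (rule maximal_ergodic_iid[OF indep_vars_compose2[OF indep, of "\<lambda>_ y. y - a" "\<lambda>_. borel"] D_distr]) (use int in auto)
    \<comment> \<open>Dropping the indicator in front of \<open>Y 0\<close> only increases the
      integrand, as \<open>Y 0\<close> is non-negative.\<close>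
    also have "\<dots> \<le> (\<integral>\<omega>. Y 0 \<omega> - a * indicator (E N) \<omega> \<partial>M)"
    proof (rule integral_mono)
      show "integrable M (\<lambda>\<omega>. indicator (E N) \<omega> * ?D 0 \<omega>)"
        by (rule Bochner_Integration.integrable_bound[of _ "?D 0"])
          (use int in \<open>auto intro!: AE_I2 split: split_indicator\<close>)
    qed (use int nonneg in \<open>auto split: split_indicator simp: less_top[symmetric]\<close>)
    also have "\<dots> = expectation (Y 0) - a * prob (E N)"
      using int by (subst Bochner_Integration.integral_diff) (auto simp: less_top[symmetric])
    finally show ?thesis by simp
  qed
  have "incseq E"
    unfolding E_def incseq_Suc_iff using max_partial_sum_le_Suc order_less_le_trans by fast
  then have "(\<lambda>N. a * prob (E N)) \<longlonglongrightarrow> a * prob (\<Union>N. E N)"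
    by (intro tendsto_mult_left finite_Lim_measure_incseq) auto
  then have "a * prob (\<Union>N. E N) \<le> expectation (Y 0)"
    by (rule LIMSEQ_le_const2) (use bound in auto)
  moreover have "{\<omega> \<in> space M. \<exists>n. (\<Sum>i<n. Y i \<omega>) > n * a} \<subseteq> (\<Union>N. E N)"
  proof safe
    fix \<omega> n assume "\<omega> \<in> space M" "(\<Sum>i<n. Y i \<omega>) > n * a"
    then have "0 < (\<Sum>i<n. ?D i \<omega>)" by (simp add: sum_subtractf)
    also have "\<dots> \<le> max_partial_sum (Suc n) (\<lambda>i. ?D i \<omega>)"
      by (rule sum_le_max_partial_sum) simp
    finally show "\<omega> \<in> (\<Union>N. E N)"
      using \<open>\<omega> \<in> space M\<close> unfolding E_def by blast
  qed
  then have "prob {\<omega> \<in> space M. \<exists>n. (\<Sum>i<n. Y i \<omega>) > n * a} \<le> prob (\<Union>N. E N)"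
    by (rule finite_measure_mono) auto
  ultimately show ?thesis
    using a mult_left_mono by (meson less_imp_le order_trans)
qed

lemma distr_compose_cong:
  assumes [measurable]: "X \<in> M \<rightarrow>\<^sub>M N" "Y \<in> M \<rightarrow>\<^sub>M N" "g \<in> N \<rightarrow>\<^sub>M L"
    and eq: "distr M N X = distr M N Y"
  shows "distr M L (\<lambda>\<omega>. g (X \<omega>)) = distr M L (\<lambda>\<omega>. g (Y \<omega>))"
proof -
  have "distr M L (\<lambda>\<omega>. g (Z \<omega>)) = distr (distr M N Z) L g" if "Z \<in> M \<rightarrow>\<^sub>M N" for Z
    using that by (subst distr_distr) (auto simp: comp_def)
  with eq show ?thesis by simp
qed

text \<open>Truncation at \<open>K\<close> splits \<open>Y\<close> into \<open>U + V\<close>.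
  Averages of \<open>U\<close> converge by the bounded law to a limit at most \<mu>. By the maximal
  inequality, averages of \<open>V\<close> ever exceed \<open>a\<close> with probability at most
  \<open>expectation (V K 0) / a\<close>, which vanishes as \<open>K\<close> grows.\<close>

lemma (in prob_space) strong_law_upper:
  fixes Y :: "nat \<Rightarrow> 'a \<Rightarrow> real"
  assumes indep: "indep_vars (\<lambda>_. borel) Y UNIV"
    and distr: "\<And>i. distr M borel (Y i) = distr M borel (Y 0)"
    and int: "integrable M (Y 0)" and nonneg: "\<And>i \<omega>. \<omega> \<in> space M \<Longrightarrow> 0 \<le> Y i \<omega>"
  shows "AE \<omega> in M. \<forall>e>0. eventually (\<lambda>n. (\<Sum>i<n. Y i \<omega>) / n \<le> expectation (Y 0) + e) sequentially"
proof -
  define \<mu> where "\<mu> = expectation (Y 0)"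
  have rv [measurable]: "random_variable borel (Y i)" for i
    using indep by (simp add: indep_vars_def2)
  define U V where "U = (\<lambda>(K::nat) i \<omega>. min (Y i \<omega>) K)" and "V = (\<lambda>(K::nat) i \<omega>. Y i \<omega> - min (Y i \<omega>) K)"
  have [measurable]: "random_variable borel (U K i)" "random_variable borel (V K i)" for K i
    unfolding U_def V_def by measurable
  have U_int: "integrable M (U K 0)" for K
    by (rule Bochner_Integration.integrable_bound[OF int]) (use nonneg[of _ 0] in \<open>auto intro!: AE_I2 simp: U_def\<close>)
  have V_int: "integrable M (V K 0)" for K
    unfolding V_def using int U_int[unfolded U_def] by (rule Bochner_Integration.integrable_diff)
  have U_le: "expectation (U K 0) \<le> \<mu>" for K
    unfolding \<mu>_def using U_int int by (rule integral_mono) (auto simp: U_def)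
  have U_lim: "AE \<omega> in M. \<forall>K. (\<lambda>n. (\<Sum>i<n. U K i \<omega>) / n) \<longlonglongrightarrow> expectation (U K 0)"
    unfolding AE_all_countable
  proof
    fix K
    show "AE \<omega> in M. (\<lambda>n. (\<Sum>i<n. U K i \<omega>) / n) \<longlonglongrightarrow> expectation (U K 0)"
    proof (rule strong_law_bounded)
      show "indep_vars (\<lambda>_. borel) (U K) UNIV"
        unfolding U_def by (rule indep_vars_compose2[OF indep, of "\<lambda>_ y. min y (real K)"]) simp
      show "distr M borel (U K i) = distr M borel (U K 0)" for i
        unfolding U_def by (rule distr_compose_cong[OF _ _ _ distr, where g = "\<lambda>y. min y (real K)"]) auto
      show "U K i \<omega> \<in> {0..real K}" if "\<omega> \<in> space M" for i \<omega>
        using nonneg[OF that] by (auto simp: U_def)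
    qed
  qed
  have V_lim: "(\<lambda>K. expectation (V K 0)) \<longlonglongrightarrow> 0"
  proof -
    have "(\<lambda>K. expectation (V K 0)) \<longlonglongrightarrow> (\<integral>\<omega>. 0 \<partial>M)"
    proof (rule integral_dominated_convergence[where w = "Y 0"])
      show "AE \<omega> in M. (\<lambda>K. V K 0 \<omega>) \<longlonglongrightarrow> 0"
      proof (rule AE_I2)
        fix \<omega>
        obtain K0 :: nat where "Y 0 \<omega> \<le> K0" using real_arch_simple by blast
        then have "\<forall>\<^sub>F K in sequentially. V K 0 \<omega> = 0"
          unfolding eventually_sequentially V_def by (intro exI[of _ K0]) (auto simp: min_def)
        then show "(\<lambda>K. V K 0 \<omega>) \<longlonglongrightarrow> 0" by (rule tendsto_eventually)
      qed
    qed (use int nonneg[of _ 0] in \<open>auto intro!: AE_I2 simp: V_def min_def\<close>)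
    then show ?thesis by simp
  qed
  have "AE \<omega> in M. eventually (\<lambda>n. (\<Sum>i<n. Y i \<omega>) / n \<le> \<mu> + 2 * a) sequentially" if a: "a > 0" for a
  proof -
    define E where "E = (\<lambda>K. {\<omega> \<in> space M. \<exists>n. (\<Sum>i<n. V K i \<omega>) > n * a})"
    have [measurable]: "E K \<in> events" for K
      unfolding E_def by measurable
    have "a * prob (E K) \<le> expectation (V K 0)" for K
      unfolding E_def
    proof (rule maximal_inequality_iid)
      show "indep_vars (\<lambda>_. borel) (V K) UNIV"
        unfolding V_def by (rule indep_vars_compose2[OF indep, of "\<lambda>_ y. y - min y (real K)"]) simp
      show "distr M borel (V K i) = distr M borel (V K 0)" for i
        unfolding V_def by (rule distr_compose_cong[OF _ _ _ distr, where g = "\<lambda>y. y - min y (real K)"]) auto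
    qed (use V_int a in \<open>auto simp: V_def\<close>)
    then have "a * prob (\<Inter>K. E K) \<le> expectation (V K 0)" for K
      using a finite_measure_mono[of "\<Inter>K. E K" "E K"]
      by (smt (verit) INF_lower UNIV_I \<open>\<And>K. E K \<in> events\<close> mult_left_mono)
    then have "a * prob (\<Inter>K. E K) \<le> 0"
      by (intro LIMSEQ_le_const[OF V_lim]) auto
    then have "prob (\<Inter>K. E K) = 0"
      using a by (simp add: mult_le_0_iff measure_le_0_iff)
    then have "AE \<omega> in M. \<omega> \<notin> (\<Inter>K. E K)"
      by (intro AE_not_in) (auto simp: null_sets_def emeasure_eq_measure)
    with U_lim AE_space show ?thesis
    proof eventually_elim
      case (elim \<omega>)
      \<comment> \<open>The truncation level depends on \<omega>; for it the tail averages are at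
        most \<open>a\<close> for every \<open>n\<close>. The other \<open>a\<close> in the bound
        absorbs the convergence of the truncated averages.\<close>
      then obtain K where K: "\<omega> \<notin> E K" by auto
      have "\<forall>\<^sub>F n in sequentially. (\<Sum>i<n. U K i \<omega>) / n < \<mu> + a"
        using elim(1) U_le[of K] a by (intro order_tendstoD(2)[of _ "expectation (U K 0)"]) auto
      with eventually_gt_at_top[of 0] show ?case
      proof eventually_elim
        case (elim n)
        have "(\<Sum>i<n. V K i \<omega>) \<le> n * a"
          using K \<open>\<omega> \<in> space M\<close> by (auto simp: E_def not_less)
        then have "(\<Sum>i<n. V K i \<omega>) / n \<le> a"
          using elim by (simp add: field_simps)
        moreover have "(\<Sum>i<n. Y i \<omega>) / n = (\<Sum>i<n. U K i \<omega>) / n + (\<Sum>i<n. V K i \<omega>) / n"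
          by (simp add: U_def V_def flip: sum.distrib add_divide_distrib)
        ultimately show ?case using elim by simp
      qed
    qed
  qed
  then have "AE \<omega> in M. \<forall>m. eventually (\<lambda>n. (\<Sum>i<n. Y i \<omega>) / n \<le> \<mu> + 2 * inverse (Suc m)) sequentially"
    by (auto simp: AE_all_countable)
  then show ?thesis
  proof eventually_elim
    case (elim \<omega>)
    show ?case
      unfolding \<mu>_def[symmetric]
    proof (intro allI impI)
      fix e :: real assume "e > 0"
      then obtain m where "inverse (Suc m) < e / 2" using reals_Archimedean[of "e / 2"] by auto
      with elim[rule_format, of m] show "\<forall>\<^sub>F n in sequentially. (\<Sum>i<n. Y i \<omega>) / real n \<le> \<mu> + e"
        by (auto elim!: eventually_mono)
    qed
  qed
qed

subsection \<open>Empirical measures\<close>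

lemma sets_empirical_measure: "sets (empirical_measure n x) = sets borel"
  by (simp add: empirical_measure_def)

lemma measurable_uniform_count_measure_borel: "x \<in> uniform_count_measure {..<n} \<rightarrow>\<^sub>M borel"
  by (simp add: measurable_def sets_uniform_count_measure space_uniform_count_measure)

text \<open>For \<open>n = 0\<close> the empirical measure is the zero measure, whence the
  restriction to \<open>n \<ge> 1\<close> here and in the deterministic arguments below.\<close>

lemma prob_space_empirical_measure:
  assumes "n \<ge> 1"
  shows "prob_space (empirical_measure n x)"
proof -
  have "prob_space (uniform_count_measure {..<n})"
    using assms by (intro prob_space_uniform_count_measure) (auto simp: lessThan_empty_iff)
  then show ?thesis
    unfolding empirical_measure_def
    by (rule prob_space.prob_space_distr) (rule measurable_uniform_count_measure_borel)
qed

lemma nn_integral_empirical_measure: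
  assumes "g \<in> borel_measurable borel" "\<And>y. 0 \<le> g y"
  shows "(\<integral>\<^sup>+ y. ennreal (g y) \<partial>empirical_measure n x) = ennreal ((\<Sum>i<n. g (x i)) / n)"
proof -
  have "(\<integral>\<^sup>+ y. ennreal (g y) \<partial>empirical_measure n x) = (\<integral>\<^sup>+ i. ennreal (g (x i)) \<partial>uniform_count_measure {..<n})"
    unfolding empirical_measure_def
    using assms(1) measurable_uniform_count_measure_borel by (intro nn_integral_distr) auto
  also have "\<dots> = (\<Sum>i<n. ennreal (1 / n) * ennreal (g (x i)))"
    unfolding uniform_count_measure_def by (subst nn_integral_point_measure_finite) auto
  also have "\<dots> = ennreal ((\<Sum>i<n. g (x i)) / n)"
    using assms(2) by (simp add: sum_divide_distrib flip: ennreal_mult)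
  finally show ?thesis .
qed

lemma measure_empirical_measure:
  assumes "B \<in> sets borel"
  shows "measure (empirical_measure n x) B = (\<Sum>i<n. indicator B (x i)) / n"
proof -
  have "emeasure (empirical_measure n x) B = (\<integral>\<^sup>+ y. ennreal (indicator B y) \<partial>empirical_measure n x)"
    using assms by (simp add: sets_empirical_measure ennreal_indicator)
  also have "\<dots> = ennreal ((\<Sum>i<n. indicator B (x i)) / n)"
    using assms by (intro nn_integral_empirical_measure) auto
  finally show ?thesis
    by (simp add: measure_def sum_nonneg)
qed

text \<open>This is the bounded strong law for the indicators of the events
  \<open>X i \<in> A\<close>.\<close>

lemma (in prob_space) empirical_measure_tendsto:
  fixes X :: "nat \<Rightarrow> 'a \<Rightarrow> real^'p"
  assumes indep: "indep_vars (\<lambda>_. borel) X UNIV"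
    and distr: "\<And>i. distr M borel (X i) = P" and A: "A \<in> sets borel"
  shows "AE \<omega> in M. (\<lambda>n. measure (empirical_measure n (\<lambda>i. X i \<omega>)) A) \<longlonglongrightarrow> measure P A"
proof -
  have rv [measurable]: "random_variable borel (X i)" for i
    using indep by (simp add: indep_vars_def2)
  note [measurable] = A
  have "AE \<omega> in M. (\<lambda>n. (\<Sum>i<n. indicator A (X i \<omega>)) / n) \<longlonglongrightarrow> expectation (\<lambda>\<omega>. indicator A (X 0 \<omega>))"
  proof (rule strong_law_bounded)
    show "indep_vars (\<lambda>_. borel) (\<lambda>i \<omega>. indicator A (X i \<omega>) :: real) UNIV"
      by (rule indep_vars_compose2[OF indep, of "\<lambda>_. indicator A"]) measurable
    show "distr M borel (\<lambda>\<omega>. indicator A (X i \<omega>) :: real) = distr M borel (\<lambda>\<omega>. indicator A (X 0 \<omega>))" for i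
      by (rule distr_compose_cong[where N = borel]) (use distr in auto)
    show "indicator A (X i \<omega>) \<in> {0..1 :: real}" for i \<omega>
      by (simp add: indicator_def)
  qed
  moreover have "expectation (\<lambda>\<omega>. indicator A (X 0 \<omega>)) = measure P A"
  proof -
    have "expectation (\<lambda>\<omega>. indicator A (X 0 \<omega>)) = (\<integral>x. indicator A x \<partial>distr M borel (X 0) :: real)"
      by (subst integral_distr) auto
    also have "\<dots> = measure (distr M borel (X 0)) A"
      by simp
    finally show ?thesis unfolding distr .
  qed
  ultimately show ?thesis
    using A by (simp add: measure_empirical_measure)
qed

text \<open>The upper strong law is applied to \<open>g (X i)\<close>; if the integral under
  \<open>P\<close> is infinite, the bound is trivial. The result will be used for the loss of one
  fixed optimal parameter.\<close>

lemma (in prob_space) limsup_nn_integral_empirical_measure_le: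
  fixes X :: "nat \<Rightarrow> 'a \<Rightarrow> real^'p"
  assumes indep: "indep_vars (\<lambda>_. borel) X UNIV"
    and distr: "\<And>i. distr M borel (X i) = P"
    and g: "g \<in> borel_measurable borel" "\<And>y. 0 \<le> g y"
  shows "AE \<omega> in M. limsup (\<lambda>n. \<integral>\<^sup>+ x. ennreal (g x) \<partial>empirical_measure n (\<lambda>i. X i \<omega>)) \<le> (\<integral>\<^sup>+ x. ennreal (g x) \<partial>P)"
proof (cases "(\<integral>\<^sup>+ x. ennreal (g x) \<partial>P) < \<infinity>")
  case True
  have rv [measurable]: "random_variable borel (X i)" for i
    using indep by (simp add: indep_vars_def2)
  note [measurable] = g(1)
  have P: "(\<integral>\<^sup>+ x. ennreal (g x) \<partial>P) = (\<integral>\<^sup>+ \<omega>. ennreal (g (X 0 \<omega>)) \<partial>M)"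
    unfolding distr[of 0, symmetric] by (rule nn_integral_distr) auto
  have int: "integrable M (\<lambda>\<omega>. g (X 0 \<omega>))"
    using True g(2) unfolding P by (intro integrableI_nonneg) auto
  have P': "(\<integral>\<^sup>+ x. ennreal (g x) \<partial>P) = ennreal (expectation (\<lambda>\<omega>. g (X 0 \<omega>)))"
    unfolding P by (rule nn_integral_eq_integral[OF int]) (use g(2) in auto)
  have "AE \<omega> in M. \<forall>e>0. \<forall>\<^sub>F n in sequentially. (\<Sum>i<n. g (X i \<omega>)) / n \<le> expectation (\<lambda>\<omega>. g (X 0 \<omega>)) + e"
  proof (rule strong_law_upper[where Y = "\<lambda>i \<omega>. g (X i \<omega>)", OF _ _ int])
    show "indep_vars (\<lambda>_. borel) (\<lambda>i \<omega>. g (X i \<omega>)) UNIV"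
      by (rule indep_vars_compose2[OF indep, of "\<lambda>_. g"]) simp
    show "distr M borel (\<lambda>\<omega>. g (X i \<omega>)) = distr M borel (\<lambda>\<omega>. g (X 0 \<omega>))" for i
      by (rule distr_compose_cong[where N = borel]) (use distr in auto)
  qed (rule g(2))
  then show ?thesis
  proof eventually_elim
    case (elim \<omega>)
    show ?case
      unfolding P' nn_integral_empirical_measure[OF g]
    proof (rule ennreal_le_epsilon)
      fix e :: real assume "0 < e"
      have "limsup (\<lambda>n. ennreal ((\<Sum>i<n. g (X i \<omega>)) / n)) \<le> ennreal (expectation (\<lambda>\<omega>. g (X 0 \<omega>)) + e)"
        using elim \<open>0 < e\<close> by (intro Limsup_bounded) (auto elim!: eventually_mono intro: ennreal_leI)
      also have "\<dots> = ennreal (expectation (\<lambda>\<omega>. g (X 0 \<omega>))) + ennreal e"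
        using \<open>0 < e\<close> g(2) by (intro ennreal_plus) (auto intro!: Bochner_Integration.integral_nonneg)
      finally show "limsup (\<lambda>n. ennreal ((\<Sum>i<n. g (X i \<omega>)) / n)) \<le> ennreal (expectation (\<lambda>\<omega>. g (X 0 \<omega>))) + ennreal e" .
    qed
  qed
qed (auto simp: less_top[symmetric])

subsection \<open>Uniform comparison of integrals of equicontinuous functions\<close>

text \<open>Balls of radius \<open>\<delta> / 2\<close> around the points of a countable dense set
  cover the space; making them disjoint one after another only shrinks them.\<close>

lemma small_cells:
  fixes \<delta> :: real
  assumes "\<delta> > 0"
  obtains B :: "nat \<Rightarrow> 'b :: {metric_space, second_countable_topology} set"
  where "\<And>j. B j \<in> sets borel" "disjoint_family B" "(\<Union>j. B j) = UNIV"
    "\<And>j x y. x \<in> B j \<Longrightarrow> y \<in> B j \<Longrightarrow> dist x y < \<delta>"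
proof -
  obtain D :: "'b set" where D: "countable D" "\<And>X. open X \<Longrightarrow> X \<noteq> {} \<Longrightarrow> \<exists>d\<in>D. d \<in> X"
    by (rule countable_dense_setE) blast
  from D(2)[of UNIV] have "D \<noteq> {}" by auto
  define B where "B = disjointed (\<lambda>j. ball (from_nat_into D j) (\<delta> / 2))"
  show thesis
  proof (rule that[of B])
    have "range B \<subseteq> sets borel"
      unfolding B_def by (rule sets.range_disjointed_sets) auto
    then show "B j \<in> sets borel" for j by auto
    show "disjoint_family B" unfolding B_def by (rule disjoint_family_disjointed)
    have "x \<in> (\<Union>j. ball (from_nat_into D j) (\<delta> / 2))" for x
    proof -
      obtain d where "d \<in> D" "d \<in> ball x (\<delta> / 2)"
        using D(2)[of "ball x (\<delta> / 2)"] assms by auto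
      then obtain j where "d = from_nat_into D j"
        using D(1) from_nat_into_surj by metis
      with \<open>d \<in> ball x (\<delta> / 2)\<close> show ?thesis
        by (auto simp: dist_commute)
    qed
    then show "(\<Union>j. B j) = UNIV"
      unfolding B_def UN_disjointed_eq by auto
    fix j x y assume "x \<in> B j" "y \<in> B j"
    then have "x \<in> ball (from_nat_into D j) (\<delta> / 2)" "y \<in> ball (from_nat_into D j) (\<delta> / 2)"
      unfolding B_def using disjointed_subset[of "\<lambda>j. ball (from_nat_into D j) (\<delta> / 2)" j] by auto
    then show "dist x y < \<delta>"
      using dist_triangle_half_r[of "from_nat_into D j" x \<delta> y] by simp
  qed
qed

text \<open>One fine partition approximates every \<open>h\<close> in \<open>H\<close> by a step
  function with values between 0 and \<open>T\<close>. Finitely many cells carry almost all of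
  \<open>Q\<close>, and on these the measures converge; the threshold for \<open>n\<close> depends
  on the cells only, not on \<open>h\<close>. As \<open>h\<close> is non-negative, mass of
  \<open>N n\<close> outside these cells can be ignored, so the bound is one-sided.\<close>

lemma integral_le_equicontinuous:
  fixes N :: "nat \<Rightarrow> 'b :: {metric_space, second_countable_topology} measure"
    and B :: "nat \<Rightarrow> nat \<Rightarrow> 'b set"
  assumes N: "\<And>n. n \<ge> 1 \<Longrightarrow> prob_space (N n)" "\<And>n. n \<ge> 1 \<Longrightarrow> sets (N n) = sets borel"
    and Q: "prob_space Q" "sets Q = sets borel"
    and B: "\<And>m j. B m j \<in> sets borel" "\<And>m. disjoint_family (B m)" "\<And>m. (\<Union>j. B m j) = UNIV"
      "\<And>m j x y. x \<in> B m j \<Longrightarrow> y \<in> B m j \<Longrightarrow> dist x y < inverse (Suc m)"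
    and lim: "\<And>m j. (\<lambda>n. measure (N n) (B m j)) \<longlonglongrightarrow> measure Q (B m j)"
    and bounds: "\<And>h x. h \<in> H \<Longrightarrow> h x \<in> {0..T}"
    and cont: "\<And>e. e > 0 \<Longrightarrow> \<exists>d>0. \<forall>h\<in>H. \<forall>x y. dist x y < d \<longrightarrow> h x \<le> h y + e"
    and e: "e > 0" and T: "T > 0"
  shows "\<forall>\<^sub>F n in sequentially. \<forall>h\<in>H. (\<integral>x. h x \<partial>Q) \<le> (\<integral>x. h x \<partial>N n) + (e :: real)"
proof -
  interpret Q: prob_space Q by fact
  obtain d where "d > 0" and d: "\<And>h x y. h \<in> H \<Longrightarrow> dist x y < d \<Longrightarrow> h x \<le> h y + e / 4"
    using cont[of "e / 4"] e by auto
  obtain m where m: "inverse (real (Suc m)) < d"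
    using reals_Archimedean \<open>d > 0\<close> by blast
  define C where "C = B m"
  have C [measurable]: "C j \<in> sets borel" for j unfolding C_def by (rule B)
  have disj: "disjoint_family C" and UN: "(\<Union>j. C j) = UNIV"
    unfolding C_def by (rule B)+
  have osc: "h x \<le> h y + e / 4" if "h \<in> H" "x \<in> C j" "y \<in> C j" for h x y j
    using d[OF that(1)] B(4)[of x m j y] that m unfolding C_def by fastforce
  have UN_Q: "(\<Union>j. C j) = space Q"
    using UN sets_eq_imp_space_eq[OF Q(2)] by simp
  have "(\<lambda>j. measure Q (C j)) sums 1"
    using Q.finite_measure_UNION[OF _ disj] Q.prob_space UN_Q C Q(2) by (simp add: image_subset_iff)
  then have "(\<lambda>J. \<Sum>j<J. measure Q (C j)) \<longlonglongrightarrow> 1" by (simp add: sums_def)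
  then have "\<forall>\<^sub>F J in sequentially. (\<Sum>j<J. measure Q (C j)) > 1 - e / (4 * T)"
    using e T by (intro order_tendstoD) auto
  then obtain J where J: "(\<Sum>j<J. measure Q (C j)) > 1 - e / (4 * T)"
    by (auto simp: eventually_sequentially)
  \<comment> \<open>This makes the total error over \<open>J\<close> cells, each weighted by at most
    \<open>T\<close>, no more than \<open>e / 4\<close>; \<open>Suc J\<close> avoids division by
    0.\<close>
  define \<eta> where "\<eta> = e / (4 * T * Suc J)"
  have "\<eta> > 0" using e T by (simp add: \<eta>_def)
  have "\<forall>\<^sub>F n in sequentially. \<forall>j\<in>{..<J}. measure Q (C j) < measure (N n) (C j) + \<eta>"
  proof (rule eventually_ball_finite, simp, rule ballI)
    fix j
    have "(\<lambda>n. measure (N n) (C j) + \<eta>) \<longlonglongrightarrow> measure Q (C j) + \<eta>"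
      unfolding C_def by (intro tendsto_intros lim)
    then show "\<forall>\<^sub>F n in sequentially. measure Q (C j) < measure (N n) (C j) + \<eta>"
      by (rule order_tendstoD) (use \<open>\<eta> > 0\<close> in simp)
  qed
  with eventually_ge_at_top[of 1] show ?thesis
  proof eventually_elim
    case (elim n)
    interpret N: prob_space "N n" using N elim by blast
    note sets = N(2)[OF elim(1)] Q(2)
    show ?case
    proof
      fix h assume h: "h \<in> H"
      \<comment> \<open>A sample value of \<open>h\<close> on each cell. For an empty cell the
        choice is arbitrary, but the value still lies between 0 and \<open>T\<close>.\<close>
      define v where "v = (\<lambda>j. h (SOME x. x \<in> C j))"
      have v: "0 \<le> v j" "v j \<le> T" for j
        using bounds[OF h] by (auto simp: v_def)
      have v_osc: "h x \<le> v j + e / 4" "v j \<le> h x + e / 4" if "x \<in> C j" for x j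
        using osc[OF h] that someI[of "\<lambda>x. x \<in> C j" x] by (auto simp: v_def)
      define s where "s = (\<lambda>x. \<Sum>j<J. v j * indicator (C j) x)"
      have s_eq: "s x = v j" if "x \<in> C j" "j < J" for x j
      proof -
        have "s x = (\<Sum>i<J. if i = j then v j else 0)"
          unfolding s_def
        proof (rule sum.cong)
          fix i
          show "v i * indicator (C i) x = (if i = j then v j else 0)"
            using disj that(1) by (auto simp: disjoint_family_on_def split: split_indicator)
        qed simp
        with that show ?thesis by simp
      qed
      have s_0: "s x = 0" if "\<And>j. j < J \<Longrightarrow> x \<notin> C j" for x
        unfolding s_def using that by (intro sum.neutral) auto
      define R where "R = UNIV - (\<Union>j<J. C j)"
      have [measurable]: "R \<in> sets borel" unfolding R_def by measurable
      \<comment> \<open>Outside the first \<open>J\<close> cells \<open>s\<close> is 0: the upper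
        bound needs the extra \<open>T\<close>, while the lower bound holds because \<open>h\<close>
        is non-negative.\<close>
      have "h x \<le> s x + e / 4 + T * indicator R x \<and> s x - e / 4 \<le> h x" for x
      proof (cases "\<exists>j<J. x \<in> C j")
        case True
        then obtain j where j: "j < J" "x \<in> C j" by blast
        then have "x \<notin> R" by (auto simp: R_def)
        with s_eq[OF j(2,1)] v_osc[OF j(2)] show ?thesis by simp
      next
        case False
        then have "s x = 0" by (intro s_0) blast
        moreover from False have "x \<in> R" by (auto simp: R_def)
        ultimately show ?thesis using bounds[OF h, of x] e by simp
      qed
      then have upper: "h x \<le> s x + e / 4 + T * indicator R x" and lower: "s x - e / 4 \<le> h x" for x
        by blast+
      \<comment> \<open>Exchanging the two points turns the one-sided estimate of
        \<open>cont\<close> into a two-sided one; measurability of \<open>h\<close> follows from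
        continuity.\<close>
      have "continuous_on UNIV h"
        unfolding continuous_on_iff
      proof (intro ballI allI impI)
        fix x :: 'b and \<epsilon> :: real assume "\<epsilon> > 0"
        then obtain d where "d > 0" "\<And>x y. dist x y < d \<Longrightarrow> h x \<le> h y + \<epsilon> / 2"
          using cont[of "\<epsilon> / 2"] h by auto
        then show "\<exists>d>0. \<forall>x'\<in>UNIV. dist x' x < d \<longrightarrow> dist (h x') (h x) < \<epsilon>"
          using \<open>\<epsilon> > 0\<close> by (intro exI[of _ d]) (smt (verit) dist_commute dist_real_def field_sum_of_halves)
      qed
      then have h_meas: "h \<in> borel_measurable borel" by (rule borel_measurable_continuous_onI)
      have h_meas' [measurable]: "h \<in> borel_measurable Q" "h \<in> borel_measurable (N n)"
        using h_meas sets by (simp_all cong: measurable_cong_sets)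
      have C' [measurable]: "C j \<in> sets Q" "C j \<in> sets (N n)" "R \<in> sets Q" for j
        using sets by simp_all
      have int: "integrable Q h" "integrable (N n) h"
        using bounds[OF h] by (auto intro!: Q.integrable_const_bound[of _ T] N.integrable_const_bound[of _ T])
      have int_v: "integrable Q (\<lambda>x. v j * indicator (C j) x)" "integrable (N n) (\<lambda>x. v j * indicator (C j) x)" for j
        by (auto intro!: integrable_mult_right integrable_real_indicator simp: less_top[symmetric])
      have int_s: "integrable Q s" "integrable (N n) s"
        unfolding s_def by (intro Bochner_Integration.integrable_sum int_v)+
      have integral_v: "(\<integral>x. v j * indicator (C j) x \<partial>Q) = v j * measure Q (C j)"
          "(\<integral>x. v j * indicator (C j) x \<partial>N n) = v j * measure (N n) (C j)" for j
        by (simp_all add: sets_eq_imp_space_eq[OF sets(1)] sets_eq_imp_space_eq[OF sets(2)])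
      have integral_s: "(\<integral>x. s x \<partial>Q) = (\<Sum>j<J. v j * measure Q (C j))"
         "(\<integral>x. s x \<partial>N n) = (\<Sum>j<J. v j * measure (N n) (C j))"
        unfolding s_def integral_v[symmetric] by (intro Bochner_Integration.integral_sum int_v)+
      have "(\<integral>x. h x \<partial>Q) \<le> (\<integral>x. s x + e / 4 + T * indicator R x \<partial>Q)"
        by (rule integral_mono) (use int int_s upper in \<open>auto simp: less_top[symmetric]\<close>)
      also have "\<dots> = (\<integral>x. s x \<partial>Q) + e / 4 + T * measure Q R"
        using int_s by (simp add: less_top[symmetric] Q.prob_space)
      finally have 1: "(\<integral>x. h x \<partial>Q) \<le> (\<Sum>j<J. v j * measure Q (C j)) + e / 4 + T * measure Q R"
        unfolding integral_s .
      have "measure Q (\<Union>j<J. C j) = (\<Sum>j<J. measure Q (C j))"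
        using disj by (intro Q.finite_measure_finite_Union) (auto simp: disjoint_family_on_def)
      then have "measure Q R = 1 - (\<Sum>j<J. measure Q (C j))"
        unfolding R_def using Q.prob_compl[of "\<Union>j<J. C j"] sets_eq_imp_space_eq[OF Q(2)] by simp
      with J have "measure Q R \<le> e / (4 * T)" by linarith
      then have "T * measure Q R \<le> T * (e / (4 * T))"
        using T by (intro mult_left_mono) auto
      with T have 2: "T * measure Q R \<le> e / 4" by simp
      have "(\<integral>x. s x \<partial>N n) - e / 4 = (\<integral>x. s x - e / 4 \<partial>N n)"
        using int_s(2) by (subst Bochner_Integration.integral_diff) (auto simp: N.prob_space)
      also have "\<dots> \<le> (\<integral>x. h x \<partial>N n)"
        by (rule integral_mono) (use int int_s lower in auto)
      finally have 3: "(\<Sum>j<J. v j * measure (N n) (C j)) - e / 4 \<le> (\<integral>x. h x \<partial>N n)"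
        unfolding integral_s .
      have "(\<Sum>j<J. v j * measure Q (C j)) \<le> (\<Sum>j<J. v j * measure (N n) (C j) + T * \<eta>)"
      proof (rule sum_mono)
        fix j assume "j \<in> {..<J}"
        with elim(2) have "measure Q (C j) \<le> measure (N n) (C j) + \<eta>"
          by (auto intro: less_imp_le)
        then have "v j * measure Q (C j) \<le> v j * (measure (N n) (C j) + \<eta>)"
          using v by (intro mult_left_mono) auto
        also have "\<dots> \<le> v j * measure (N n) (C j) + T * \<eta>"
          using v[of j] \<open>\<eta> > 0\<close> by (simp add: distrib_left mult_right_mono)
        finally show "v j * measure Q (C j) \<le> v j * measure (N n) (C j) + T * \<eta>" .
      qed
      also have "\<dots> = (\<Sum>j<J. v j * measure (N n) (C j)) + J * (T * \<eta>)"
        by (simp add: sum.distrib)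
      also have "J * (T * \<eta>) = e / 4 * (J / Suc J)"
        using T by (simp add: \<eta>_def)
      also have "\<dots> \<le> e / 4 * 1"
        using e by (intro mult_left_mono) auto
      \<comment> \<open>Four errors of \<open>e / 4\<close> add up: oscillation on cells under
        \<open>Q\<close> and under \<open>N n\<close>, the mass of \<open>R\<close>, and the
        differences of the cell masses.\<close>
      finally show "(\<integral>x. h x \<partial>Q) \<le> (\<integral>x. h x \<partial>N n) + e"
        using 1 2 3 by linarith
    qed
  qed
qed

subsection \<open>Convergence of parameters\<close>

text \<open>Multiplication by \<open>A\<close> is an isometry, so Cauchy-Schwarz for
  \<open>x\<close> and \<open>A *v (transpose A *v x)\<close> bounds the squared norm of
  \<open>transpose A *v x\<close> by the product of the two norms.\<close>

lemma norm_orthonormal_transpose_mult_le: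
  fixes A :: "real^'q^'p"
  assumes "A \<in> orthonormal_matrices"
  shows "norm (transpose A *v x) \<le> norm x"
proof -
  let ?w = "transpose A *v x"
  have 1: "(A *v w) \<bullet> (A *v w) = w \<bullet> w" for w
  proof -
    have "(A *v w) \<bullet> (A *v w) = (transpose A *v (A *v w)) \<bullet> w"
      by (metis dot_lmul_matrix transpose_matrix_vector)
    also have "transpose A *v (A *v w) = w"
      using assms by (simp add: matrix_vector_mul_assoc orthonormal_matrices_def)
    finally show ?thesis .
  qed
  have "(norm ?w)\<^sup>2 = x \<bullet> (A *v ?w)"
    by (metis dot_lmul_matrix power2_norm_eq_inner transpose_matrix_vector)
  also have "\<dots> \<le> norm x * norm (A *v ?w)"
    by (rule norm_cauchy_schwarz)
  also have "norm (A *v ?w) = norm ?w"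
    using 1[of ?w] by (simp add: norm_eq_sqrt_inner)
  finally show ?thesis
    by (metis mult_right_le_imp_le norm_ge_zero norm_le_zero_iff not_le order.trans power2_eq_square)
qed

text \<open>Boundedness: each row is the image of a unit vector under the transpose. Closedness: the
  set is cut out by polynomial equations in the entries.\<close>

lemma compact_orthonormal_matrices: "compact (orthonormal_matrices :: (real^'q^'p) set)"
  unfolding compact_eq_bounded_closed
proof
  have "norm A \<le> real CARD('p)" if "A \<in> orthonormal_matrices" for A :: "real^'q^'p"
  proof -
    have row: "norm (A $ i) \<le> 1" for i
    proof -
      have "A $ i = transpose A *v axis i 1"
        by (simp add: matrix_vector_mul_component vec_eq_iff transpose_def matrix_vector_mult_def axis_def if_distrib cong: if_cong)
      then show ?thesis
        using norm_orthonormal_transpose_mult_le[OF that, of "axis i 1"] by simp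
    qed
    have "norm A \<le> (\<Sum>i\<in>UNIV. norm (A $ i))"
      unfolding norm_vec_def by (rule L2_set_le_sum) simp
    also have "\<dots> \<le> (\<Sum>i\<in>(UNIV :: 'p set). 1)"
      by (intro sum_mono row)
    finally show ?thesis by simp
  qed
  then show "bounded (orthonormal_matrices :: (real^'q^'p) set)"
    unfolding bounded_iff by blast
  have "orthonormal_matrices =
      {A :: real^'q^'p. \<forall>i j. (\<Sum>l\<in>UNIV. A $ l $ i * A $ l $ j) = mat 1 $ i $ j}"
    by (auto simp: orthonormal_matrices_def vec_eq_iff matrix_matrix_mult_def transpose_def)
  also have "closed \<dots>"
    by (intro closed_Collect_all closed_Collect_eq continuous_intros)
  finally show "closed (orthonormal_matrices :: (real^'q^'p) set)" .
qed

section \<open>Extraction of convergent or escaping subsequences\<close>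

text \<open>If the norms do not tend to infinity, infinitely many terms lie in one ball, and
  Bolzano-Weierstrass applies to them.\<close>

lemma subsequence_converges_or_escapes:
  fixes v :: "nat \<Rightarrow> 'b :: euclidean_space"
  shows "\<exists>r. strict_mono r \<and> ((\<exists>l. (\<lambda>n. v (r n)) \<longlonglongrightarrow> l) \<or> filterlim (\<lambda>n. norm (v (r n))) at_top sequentially)"
proof (cases "filterlim (\<lambda>n. norm (v n)) at_top sequentially")
  case True
  then show ?thesis by (intro exI[of _ id]) (auto simp: strict_mono_def)
next
  case False
  then obtain Z where "\<exists>\<^sub>F n in sequentially. norm (v n) < Z"
    unfolding filterlim_at_top frequently_def not_less by auto
  then have "infinite {n. norm (v n) < Z}"
    by (simp add: cofinite_eq_sequentially[symmetric] frequently_cofinite)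
  then obtain r :: "nat \<Rightarrow> nat" where r: "strict_mono r" "\<And>n. norm (v (r n)) < Z"
    using infinite_enumerate by blast
  then have "bounded (range (\<lambda>n. v (r n)))"
    by (auto simp: bounded_iff intro!: exI[of _ Z] less_imp_le)
  then obtain l s where "strict_mono s" "((\<lambda>n. v (r n)) \<circ> s) \<longlonglongrightarrow> l"
    using bounded_imp_convergent_subsequence by blast
  then show ?thesis
    using r(1) by (intro exI[of _ "r \<circ> s"]) (auto simp: strict_mono_def comp_def)
qed

text \<open>Coordinates are treated one after another; both alternatives pass to further
  subsequences, so what was achieved for earlier coordinates persists.\<close>

lemma common_subsequence_converges_or_escapes:
  fixes v :: "nat \<Rightarrow> nat \<Rightarrow> 'b :: euclidean_space"
  shows "\<exists>r. strict_mono r \<and> (\<forall>i<k. (\<exists>l. (\<lambda>n. v (r n) i) \<longlonglongrightarrow> l) \<or> filterlim (\<lambda>n. norm (v (r n) i)) at_top sequentially)"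
proof (induction k)
  case (Suc k)
  then obtain r where r: "strict_mono r"
      "\<And>i. i < k \<Longrightarrow> (\<exists>l. (\<lambda>n. v (r n) i) \<longlonglongrightarrow> l) \<or> filterlim (\<lambda>n. norm (v (r n) i)) at_top sequentially"
    by blast
  obtain s where s: "strict_mono s"
      "(\<exists>l. (\<lambda>n. v (r (s n)) k) \<longlonglongrightarrow> l) \<or> filterlim (\<lambda>n. norm (v (r (s n)) k)) at_top sequentially"
    using subsequence_converges_or_escapes[of "\<lambda>n. v (r n) k"] by blast
  have "(\<exists>l. (\<lambda>n. v (r (s n)) i) \<longlonglongrightarrow> l) \<or> filterlim (\<lambda>n. norm (v (r (s n)) i)) at_top sequentially"
    if "i < Suc k" for i
  proof (cases "i = k")
    case False
    with that have "i < k" by simp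
    with r(2) consider l where "(\<lambda>n. v (r n) i) \<longlonglongrightarrow> l" | "filterlim (\<lambda>n. norm (v (r n) i)) at_top sequentially"
      by blast
    then show ?thesis
    proof cases
      case 1
      from filterlim_compose[OF this filterlim_subseq[OF s(1)]] show ?thesis by blast
    next
      case 2
      from filterlim_compose[OF this filterlim_subseq[OF s(1)]] show ?thesis by blast
    qed
  qed (use s in simp)
  with r(1) s(1) show ?case
    by (intro exI[of _ "r \<circ> s"]) (auto simp: strict_mono_def)
qed (auto simp: strict_mono_def intro: exI[of _ id])

section \<open>Estimates for parameter distances\<close>

lemma hausdorff_dist_nonneg:
  assumes "finite E" "E \<noteq> {}" "finite G" "G \<noteq> {}"
  shows "0 \<le> hausdorff_dist E G"
proof -
  obtain a where "a \<in> E" using assms by blast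
  then obtain b where "dist a b \<le> hausdorff_dist E G"
    using hausdorff_dist_le_iff[OF assms, of "hausdorff_dist E G"] by auto
  then show ?thesis using zero_le_dist[of a b] by linarith
qed

lemma param_dist_le:
  fixes A B :: "real^'q^'p"
  assumes "finite E" "E \<noteq> {}" "finite G" "G \<noteq> {}"
  shows "param_dist (E, A) (G, B) \<le> dist A B + hausdorff_dist E G"
  unfolding param_dist_eq using hausdorff_dist_nonneg[OF assms] by (simp add: sqrt_sum_squares_le_sum)

lemma param_dist_nonneg: "0 \<le> param_dist \<theta> \<theta>'"
  by (cases \<theta>; cases \<theta>') (simp add: param_dist_eq)

text \<open>Points are matched by index. The sum is a crude bound for the largest matched distance,
  but convenient for passing to the limit.\<close>

lemma hausdorff_dist_image_le:
  fixes k :: nat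
  assumes "k > 0"
  shows "hausdorff_dist (v ` {..<k}) (l ` {..<k}) \<le> (\<Sum>i<k. dist (v i) (l i))"
proof -
  have "dist (v i) (l i) \<le> (\<Sum>i<k. dist (v i) (l i))" if "i < k" for i
    using that by (intro member_le_sum[of i]) auto
  then show ?thesis
    using assms by (subst hausdorff_dist_le_iff) auto
qed

lemma param_setdist_le:
  "\<eta> \<in> S \<Longrightarrow> param_setdist \<theta> S \<le> param_dist \<theta> \<eta>"
  unfolding param_setdist_def
  by (intro cINF_lower bdd_belowI2[of _ 0]) (auto simp: param_dist_nonneg)

lemma param_setdist_nonneg:
  "S \<noteq> {} \<Longrightarrow> 0 \<le> param_setdist \<theta> S"
  unfolding param_setdist_def by (intro cINF_greatest) (auto simp: param_dist_nonneg)

subsection \<open>The loss function\<close>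

text \<open>The integrand of \<open>Psi\<close> gets a name because it will be truncated and
  compared pointwise.\<close>

definition loss :: "(real \<Rightarrow> real) \<Rightarrow> ('q::finite, 'p::finite) param \<Rightarrow> real^'p \<Rightarrow> real" where
  "loss \<psi> \<theta> x = Min ((\<lambda>f. \<psi> (norm (transpose (snd \<theta>) *v x - f))) ` fst \<theta>)"

lemma Psi_eq_loss: "Psi \<psi> \<theta> Q = (\<integral>\<^sup>+ x. ennreal (loss \<psi> \<theta> x) \<partial>Q)"
  by (simp add: Psi_def loss_def)

lemma XiD:
  assumes "\<theta> \<in> Xi k"
  shows "finite (fst \<theta>)" "fst \<theta> \<noteq> {}" "card (fst \<theta>) \<le> k" "snd \<theta> \<in> orthonormal_matrices"
  using assms by (auto simp: Xi_def center_sets_def)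

lemma loss_le: "\<theta> \<in> Xi k \<Longrightarrow> f \<in> fst \<theta> \<Longrightarrow> loss \<psi> \<theta> x \<le> \<psi> (norm (transpose (snd \<theta>) *v x - f))"
  unfolding loss_def using XiD(1) by (intro Min_le) blast+

lemma loss_attained:
  assumes "\<theta> \<in> Xi k"
  obtains f where "f \<in> fst \<theta>" "loss \<psi> \<theta> x = \<psi> (norm (transpose (snd \<theta>) *v x - f))"
proof -
  have "loss \<psi> \<theta> x \<in> (\<lambda>f. \<psi> (norm (transpose (snd \<theta>) *v x - f))) ` fst \<theta>"
    unfolding loss_def using XiD[OF assms] by (intro Min_in) auto
  then show thesis using that by blast
qed

lemma continuous_on_Min_image:
  fixes g :: "'i \<Rightarrow> 'b :: topological_space \<Rightarrow> real"
  assumes "finite F" "F \<noteq> {}" "\<And>f. f \<in> F \<Longrightarrow> continuous_on S (g f)"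
  shows "continuous_on S (\<lambda>x. Min ((\<lambda>f. g f x) ` F))"
  using assms
proof (induction rule: finite_ne_induct)
  case (insert f F)
  then have "continuous_on S (\<lambda>x. min (g f x) (Min ((\<lambda>f. g f x) ` F)))"
    by (intro continuous_on_min) auto
  with insert show ?case by simp
qed simp

locale distortion =
  fixes \<psi> :: "real \<Rightarrow> real"
  assumes nonneg: "\<And>r. 0 \<le> \<psi> r"
    and mono: "mono \<psi>"
    and cont: "continuous_on UNIV \<psi>"
    and zero: "\<psi> 0 = 0"
begin

lemma loss_nonneg: "\<theta> \<in> Xi k \<Longrightarrow> 0 \<le> loss \<psi> \<theta> x"
  by (metis loss_attained nonneg)

lemma borel_measurable_loss:
  fixes \<theta> :: "('q::finite, 'p::finite) param"
  assumes "\<theta> \<in> Xi k"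
  shows "loss \<psi> \<theta> \<in> borel_measurable borel"
proof (rule borel_measurable_continuous_onI)
  show "continuous_on UNIV (loss \<psi> \<theta>)"
    unfolding loss_def
    by (intro continuous_on_Min_image continuous_on_compose2[OF cont] continuous_intros
        linear_continuous_on matrix_vector_mul_bounded_linear XiD[OF assms]) auto
qed

text \<open>The truncated function is monotone and bounded, so beyond some \<open>R\<close> it stays
  within \<open>e\<close> of its supremum. It vanishes for negative arguments, and on the compact
  interval in between it is uniformly continuous.\<close>

lemma truncation_uniformly_continuous:
  assumes "T \<ge> 0" "e > 0"
  shows "\<exists>d>0. \<forall>r s. dist r s < d \<longrightarrow> min T (\<psi> r) \<le> min T (\<psi> s) + e"
proof -
  define \<phi> where "\<phi> = (\<lambda>r. min T (\<psi> r))"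
  have \<phi>_mono: "\<phi> r \<le> \<phi> s" if "r \<le> s" for r s
    using monoD[OF mono that] by (auto simp: \<phi>_def)
  have \<phi>_bdd: "bdd_above (range \<phi>)" by (intro bdd_aboveI2[of _ _ T]) (simp add: \<phi>_def)
  then have "\<exists>R. (SUP r. \<phi> r) - e < \<phi> R"
    using less_cSUP_iff[of UNIV \<phi> "(SUP r. \<phi> r) - e"] assms by auto
  then obtain R where R: "(SUP r. \<phi> r) - e < \<phi> R" ..
  have top: "\<phi> r \<le> \<phi> s + e" if "R \<le> s" for r s
    using R cSUP_upper[OF _ \<phi>_bdd, of r] \<phi>_mono[OF that] by auto
  have "continuous_on {-1..\<bar>R\<bar> + 1} \<phi>"
    unfolding \<phi>_def by (intro continuous_intros continuous_on_subset[OF cont]) auto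
  then have "uniformly_continuous_on {-1..\<bar>R\<bar> + 1} \<phi>"
    by (rule compact_uniformly_continuous) simp
  then obtain d where "d > 0"
    and d: "\<And>r s. r \<in> {-1..\<bar>R\<bar> + 1} \<Longrightarrow> s \<in> {-1..\<bar>R\<bar> + 1} \<Longrightarrow> dist s r < d \<Longrightarrow> dist (\<phi> s) (\<phi> r) < e"
    unfolding uniformly_continuous_on_def using assms by metis
  have "\<phi> r \<le> \<phi> s + e" if rs: "dist r s < min d 1" for r s
  proof -
    \<comment> \<open>If neither of the first two cases holds, \<open>dist r s < 1\<close> forces
      both points into the compact interval.\<close>
    consider "R \<le> s" | "r \<le> 0" | "r \<in> {-1..\<bar>R\<bar> + 1}" "s \<in> {-1..\<bar>R\<bar> + 1}"
      using rs unfolding dist_real_def atLeastAtMost_iff by linarith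
    then show ?thesis
    proof cases
      case 2
      then have "\<phi> r \<le> \<phi> 0" by (rule \<phi>_mono)
      then have "\<phi> r \<le> 0" using zero assms by (simp add: \<phi>_def)
      moreover have "0 \<le> \<phi> s" using nonneg assms by (simp add: \<phi>_def)
      ultimately show ?thesis using assms by simp
    next
      case 3
      with d[of s r] rs show ?thesis by (auto simp: dist_real_def)
    qed (use top in auto)
  qed
  then show ?thesis
    using \<open>d > 0\<close> unfolding \<phi>_def by (intro exI[of _ "min d 1"]) auto
qed

text \<open>The centre that is best for \<open>y\<close> is also available to \<open>x\<close>, and
  its distances from the two projected points differ by at most \<open>norm (x - y)\<close>. Hence
  \<open>d\<close> depends neither on the matrix nor on the position of the centres.\<close>

lemma truncated_loss_equicontinuous:
  assumes "T \<ge> 0" "e > 0"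
  shows "\<exists>d>0. \<forall>\<theta>\<in>(Xi k :: ('q::finite, 'p::finite) param set). \<forall>x y. dist x y < d \<longrightarrow>
    min T (loss \<psi> \<theta> x) \<le> min T (loss \<psi> \<theta> y) + e"
proof -
  obtain d where "d > 0" and d: "\<And>r s. dist r s < d \<Longrightarrow> min T (\<psi> r) \<le> min T (\<psi> s) + e"
    using truncation_uniformly_continuous[OF assms] by blast
  have "min T (loss \<psi> \<theta> x) \<le> min T (loss \<psi> \<theta> y) + e"
    if \<theta>: "\<theta> \<in> Xi k" and xy: "dist x y < d" for \<theta> :: "('q, 'p) param" and x y
  proof -
    let ?B = "transpose (snd \<theta>)"
    obtain f where f: "f \<in> fst \<theta>" "loss \<psi> \<theta> y = \<psi> (norm (?B *v y - f))"
      using loss_attained[OF \<theta>] .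
    have "dist (norm (?B *v x - f)) (norm (?B *v y - f)) \<le> norm (?B *v x - f - (?B *v y - f))"
      unfolding dist_real_def by (rule norm_triangle_ineq3)
    also have "\<dots> = norm (?B *v (x - y))"
      by (simp add: matrix_vector_mult_diff_distrib)
    also have "\<dots> \<le> norm (x - y)"
      by (rule norm_orthonormal_transpose_mult_le[OF XiD(4)[OF \<theta>]])
    finally have "min T (\<psi> (norm (?B *v x - f))) \<le> min T (\<psi> (norm (?B *v y - f))) + e"
      using xy by (intro d) (simp add: dist_norm)
    with loss_le[OF \<theta> f(1), of \<psi> x] f(2) show ?thesis by simp
  qed
  with \<open>d > 0\<close> show ?thesis by blast
qed

end

subsection \<open>Limits of parameters with low risk\<close>

declare transpose_matrix_vector [simp del]

lemma min_risk_le: "\<theta> \<in> Xi j \<Longrightarrow> min_risk TYPE('q::finite) \<psi> j Q \<le> Psi \<psi> (\<theta> :: ('q, 'p::finite) param) Q"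
  unfolding min_risk_def by (rule INF_lower)

lemma singleton_in_Xi: "k \<ge> 1 \<Longrightarrow> A \<in> orthonormal_matrices \<Longrightarrow> ({f}, A) \<in> Xi k"
  by (simp add: Xi_def center_sets_def)

text \<open>Repetitions are allowed: surplus indices are sent to \<open>h 0\<close>. Every set of
  centres thus becomes a family indexed by exactly \<open>k\<close> numbers, ready for extraction of
  subsequences.\<close>

lemma finite_set_enumeration:
  assumes "finite F" "F \<noteq> {}" "card F \<le> k"
  obtains v :: "nat \<Rightarrow> 'b" where "F = v ` {..<k}"
proof -
  obtain h where h: "bij_betw h {0..<card F} F"
    using ex_bij_betw_nat_finite[OF assms(1)] by blast
  have "card F > 0" using assms by (simp add: card_gt_0_iff)
  define v where "v i = (if i < card F then h i else h 0)" for i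
  have "h ` {0..<card F} = F" using h by (rule bij_betw_imp_surj_on)
  then have "v ` {..<k} = F"
    using assms(3) \<open>card F > 0\<close> unfolding v_def by (force simp: image_iff split: if_splits)
  with that show thesis by blast
qed

context distortion
begin

text \<open>The single centre 0 already has finite risk, as \<open>transpose A\<close> does not
  increase norms.\<close>

lemma min_risk_finite:
  fixes A :: "real^'q^'p" and Q :: "(real^'p) measure"
  assumes "k \<ge> 1" "A \<in> orthonormal_matrices"
    and "(\<integral>\<^sup>+ x. ennreal (\<psi> (norm x)) \<partial>Q) < \<infinity>"
  shows "min_risk TYPE('q) \<psi> k Q < \<infinity>"
proof -
  have "min_risk TYPE('q) \<psi> k Q \<le> Psi \<psi> ({0}, A) Q"
    by (intro min_risk_le singleton_in_Xi assms)
  also have "\<dots> \<le> (\<integral>\<^sup>+ x. ennreal (\<psi> (norm x)) \<partial>Q)"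
    unfolding Psi_def using norm_orthonormal_transpose_mult_le[OF assms(2)]
    by (intro nn_integral_mono) (auto intro!: ennreal_leI monoD[OF mono])
  finally show ?thesis using assms(3) by (rule order_le_less_trans)
qed

text \<open>
  If the optimal risk were at least \<open>sup \<psi>\<close>, then for every centre \<open>f\<close> the distortion
  \<open>\<psi> \<parallel>A\<^sup>Tx - f\<parallel>\<close> would be almost surely maximal; letting \<open>f\<close> run through a countable dense set
  contradicts the continuity of \<open>\<psi>\<close> at \<open>0\<close>.
\<close>

lemma min_risk_less_distortion:
  fixes A :: "real^'q^'p" and Q :: "(real^'p) measure"
  assumes Q: "prob_space Q" "sets Q = sets borel"
    and k: "k \<ge> 1" and A: "A \<in> orthonormal_matrices"
    and fin: "(\<integral>\<^sup>+ x. ennreal (\<psi> (norm x)) \<partial>Q) < \<infinity>"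
    and nontrivial: "\<psi> s \<noteq> 0"
  shows "\<exists>\<rho>. min_risk TYPE('q) \<psi> k Q < ennreal (\<psi> \<rho>)"
proof (rule ccontr)
  assume "\<not> ?thesis"
  then have le: "ennreal (\<psi> \<rho>) \<le> min_risk TYPE('q) \<psi> k Q" for \<rho> by (simp add: not_less)
  interpret prob_space Q by fact
  obtain \<mu> where \<mu>: "0 \<le> \<mu>" "min_risk TYPE('q) \<psi> k Q = ennreal \<mu>"
    using min_risk_finite[OF k A fin] by (cases "min_risk TYPE('q) \<psi> k Q") auto
  have le': "\<psi> \<rho> \<le> \<mu>" for \<rho> using le[of \<rho>] \<mu> by simp
  \<comment> \<open>The distortion is bounded by \<mu> pointwise, yet its integral is at least
    \<mu>, since a single centre is an admissible parameter.\<close>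
  have *: "AE x in Q. \<psi> (norm (transpose A *v x - f)) = \<mu>" for f
  proof -
    let ?l = "\<lambda>x. \<psi> (norm (transpose A *v x - f))"
    have "?l = loss \<psi> ({f}, A)"
      by (simp add: loss_def fun_eq_iff)
    with borel_measurable_loss[OF singleton_in_Xi[OF k A]] have "?l \<in> borel_measurable borel"
      by metis
    then have [measurable]: "?l \<in> borel_measurable Q"
      using Q(2) by (simp cong: measurable_cong_sets)
    have int: "integrable Q ?l"
      by (rule integrable_const_bound[of _ \<mu>]) (use nonneg le' in auto)
    have "ennreal \<mu> \<le> Psi \<psi> ({f}, A) Q"
      unfolding \<mu>(2)[symmetric] by (rule min_risk_le[OF singleton_in_Xi[OF k A]])
    also have "\<dots> = (\<integral>\<^sup>+ x. ennreal (?l x) \<partial>Q)"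
      by (simp add: Psi_def)
    also have "\<dots> = ennreal (\<integral>x. ?l x \<partial>Q)"
      using int by (intro nn_integral_eq_integral) (auto simp: nonneg)
    finally have "\<mu> \<le> (\<integral>x. ?l x \<partial>Q)"
      using \<mu>(1) by (simp add: nonneg)
    moreover have "(\<integral>x. \<mu> - ?l x \<partial>Q) = \<mu> - (\<integral>x. ?l x \<partial>Q)"
      using int by (subst Bochner_Integration.integral_diff) (auto simp: prob_space)
    moreover have "0 \<le> (\<integral>x. \<mu> - ?l x \<partial>Q)"
      by (intro Bochner_Integration.integral_nonneg) (use le' in auto)
    ultimately have "(\<integral>x. \<mu> - ?l x \<partial>Q) = 0" by simp
    then have "AE x in Q. \<mu> - ?l x = 0"
      using int le' by (subst (asm) integral_nonneg_eq_0_iff_AE) auto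
    then show ?thesis by eventually_elim simp
  qed
  obtain D :: "(real^'q) set" where D: "countable D" "\<And>X. open X \<Longrightarrow> X \<noteq> {} \<Longrightarrow> \<exists>d\<in>D. d \<in> X"
    by (rule countable_dense_setE) blast
  have "AE x in Q. \<forall>f\<in>D. \<psi> (norm (transpose A *v x - f)) = \<mu>"
    using * D(1) by (simp add: AE_ball_countable)
  then obtain x where x: "\<And>f. f \<in> D \<Longrightarrow> \<psi> (norm (transpose A *v x - f)) = \<mu>"
    using eventually_happens'[OF ae_filter_bot] by blast
  have "0 < \<mu>"
    using le'[of s] nonneg[of s] nontrivial by linarith
  moreover have "(\<psi> \<longlongrightarrow> 0) (at 0)"
    using cont zero by (metis UNIV_I continuous_on_def)
  ultimately have "\<forall>\<^sub>F t in at 0. \<psi> t < \<mu>" by (intro order_tendstoD)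
  then obtain d where d: "d > 0" "\<And>t. t \<noteq> 0 \<Longrightarrow> dist t 0 < d \<Longrightarrow> \<psi> t < \<mu>"
    unfolding eventually_at by auto
  obtain f where "f \<in> D" "f \<in> ball (transpose A *v x) d"
    using D(2)[of "ball (transpose A *v x) d"] d(1) by auto
  then have "\<psi> (norm (transpose A *v x - f)) < \<mu>"
    \<comment> \<open>The punctured neighbourhood excludes 0, so the case that \<open>f\<close>
      equals the projected point is settled by \<open>\<psi> 0 = 0\<close>.\<close>
    using d(2)[of "norm (transpose A *v x - f)"] zero \<open>0 < \<mu>\<close>
    by (cases "norm (transpose A *v x - f) = 0") (auto simp: dist_norm)
  with x[OF \<open>f \<in> D\<close>] show False by simp
qed

text \<open>
  Centres that escape to infinity eventually serve no point better than any convergent one, so in the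
  limit only the convergent centres matter. If fewer than \<open>k\<close> of them remained, \<open>strict\<close> would be
  violated; if none remained, the previous lemma would be.
\<close>

lemma subsequence_converges_to_low_risk:
  fixes \<theta> :: "nat \<Rightarrow> ('q::finite, 'p::finite) param"
  assumes Q: "prob_space Q" "sets Q = sets borel"
    and k: "k \<ge> 1" and \<theta>: "\<And>n. \<theta> n \<in> Xi k"
    and fin: "(\<integral>\<^sup>+ x. ennreal (\<psi> (norm x)) \<partial>Q) < \<infinity>"
    and nontrivial: "\<psi> s \<noteq> 0"
    and strict: "\<And>j. 1 \<le> j \<Longrightarrow> j < k \<Longrightarrow> min_risk TYPE('q) \<psi> j Q > min_risk TYPE('q) \<psi> k Q"
    and c: "\<And>T. T \<ge> 0 \<Longrightarrow> limsup (\<lambda>n. \<integral>\<^sup>+ x. ennreal (min T (loss \<psi> (\<theta> n) x)) \<partial>Q) \<le> c"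
    and c_le: "c \<le> min_risk TYPE('q) \<psi> k Q"
  shows "\<exists>r \<theta>'. strict_mono r \<and> \<theta>' \<in> Xi k \<and> Psi \<psi> \<theta>' Q \<le> c \<and> (\<lambda>n. param_dist (\<theta> (r n)) \<theta>') \<longlonglongrightarrow> 0"
proof -
  interpret prob_space Q by fact
  have "\<exists>v :: nat \<Rightarrow> real^'q. fst (\<theta> n) = v ` {..<k}" for n
    using finite_set_enumeration[OF XiD(1-3)[OF \<theta>]] by metis
  then obtain v where v: "\<And>n. fst (\<theta> n) = v n ` {..<k}" by metis
  obtain r1 where r1: "strict_mono r1"
      "\<And>i. i < k \<Longrightarrow> (\<exists>l. (\<lambda>n. v (r1 n) i) \<longlonglongrightarrow> l) \<or> filterlim (\<lambda>n. norm (v (r1 n) i)) at_top sequentially"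
    using common_subsequence_converges_or_escapes[of k v] by blast
  obtain A r2 where A: "A \<in> orthonormal_matrices" and r2: "strict_mono r2"
      and "((\<lambda>n. snd (\<theta> (r1 n))) \<circ> r2) \<longlonglongrightarrow> A"
    using compact_orthonormal_matrices[unfolded compact_def, rule_format, of "\<lambda>n. snd (\<theta> (r1 n))"] XiD(4)[OF \<theta>]
    by blast
  define r where "r = r1 \<circ> r2"
  have r: "strict_mono r" unfolding r_def using r1(1) r2 by (rule strict_mono_o)
  have A_lim: "(\<lambda>n. snd (\<theta> (r n))) \<longlonglongrightarrow> A"
    using \<open>((\<lambda>n. snd (\<theta> (r1 n))) \<circ> r2) \<longlonglongrightarrow> A\<close> by (simp add: r_def comp_def)
  have v_lim: "(\<exists>l. (\<lambda>n. v (r n) i) \<longlonglongrightarrow> l) \<or> filterlim (\<lambda>n. norm (v (r n) i)) at_top sequentially"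
    if "i < k" for i
    using r1(2)[OF that]
  proof
    assume "\<exists>l. (\<lambda>n. v (r1 n) i) \<longlonglongrightarrow> l"
    then obtain l where "(\<lambda>n. v (r1 n) i) \<longlonglongrightarrow> l" ..
    from filterlim_compose[OF this filterlim_subseq[OF r2]] show ?thesis by (auto simp: r_def)
  next
    assume "filterlim (\<lambda>n. norm (v (r1 n) i)) at_top sequentially"
    from filterlim_compose[OF this filterlim_subseq[OF r2]] show ?thesis by (auto simp: r_def)
  qed
  \<comment> \<open>The indices of the centres that survive in the limit.\<close>
  define J where "J = {i. i < k \<and> (\<exists>l. (\<lambda>n. v (r n) i) \<longlonglongrightarrow> l)}"
  have "\<exists>l. \<forall>i\<in>J. (\<lambda>n. v (r n) i) \<longlonglongrightarrow> l i"
    by (intro bchoice) (simp add: J_def)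
  then obtain l where l: "\<And>i. i \<in> J \<Longrightarrow> (\<lambda>n. v (r n) i) \<longlonglongrightarrow> l i"
    by blast
  have escape: "filterlim (\<lambda>n. norm (v (r n) i)) at_top sequentially" if "i < k" "i \<notin> J" for i
    using v_lim[OF that(1)] that by (auto simp: J_def)
  have J: "finite J" "J \<subseteq> {..<k}" unfolding J_def by auto
  have proj_lim: "(\<lambda>n. transpose (snd (\<theta> (r n))) *v x) \<longlonglongrightarrow> transpose A *v x" for x
    unfolding transpose_matrix_vector vector_matrix_mult_def
    by (intro vec_tendstoI) (auto intro!: tendsto_sum tendsto_mult tendsto_vec_nth A_lim)
  \<comment> \<open>Lower semicontinuity of the losses in the limit. Surviving centres are handled
    by continuity of \<open>\<psi>\<close>; escaping ones end up farther than \<rho> from the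
    projected point, because its norm is at most \<open>norm x\<close>.\<close>
  have lower: "\<forall>\<^sub>F n in sequentially. y < min T (loss \<psi> (\<theta> (r n)) x)"
    if T: "y < T" and yJ: "\<And>i. i \<in> J \<Longrightarrow> y < \<psi> (norm (transpose A *v x - l i))" and \<rho>: "y < \<psi> \<rho>"
    for y T x \<rho>
  proof -
    have "\<forall>\<^sub>F n in sequentially. \<forall>i\<in>{..<k}. y < \<psi> (norm (transpose (snd (\<theta> (r n))) *v x - v (r n) i))"
    proof (rule eventually_ball_finite, simp, rule ballI)
      fix i assume "i \<in> {..<k}"
      show "\<forall>\<^sub>F n in sequentially. y < \<psi> (norm (transpose (snd (\<theta> (r n))) *v x - v (r n) i))"
      proof (cases "i \<in> J")
        case True
        have "isCont \<psi> t" for t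
          using cont by (simp add: continuous_on_eq_continuous_at)
        then have "(\<lambda>n. \<psi> (norm (transpose (snd (\<theta> (r n))) *v x - v (r n) i)))
            \<longlonglongrightarrow> \<psi> (norm (transpose A *v x - l i))"
          by (rule isCont_tendsto_compose) (intro tendsto_intros proj_lim l True)
        from order_tendstoD(1)[OF this yJ[OF True]] show ?thesis .
      next
        case False
        with \<open>i \<in> {..<k}\<close> have "\<forall>\<^sub>F n in sequentially. \<rho> + norm x \<le> norm (v (r n) i)"
          using escape[of i] by (simp add: filterlim_at_top)
        then show ?thesis
        proof eventually_elim
          case (elim n)
          have "\<rho> \<le> norm (v (r n) i) - norm (transpose (snd (\<theta> (r n))) *v x)"
            using elim norm_orthonormal_transpose_mult_le[OF XiD(4)[OF \<theta>], of "r n" x] by linarith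
          also have "\<dots> \<le> norm (transpose (snd (\<theta> (r n))) *v x - v (r n) i)"
            by (metis norm_minus_commute norm_triangle_ineq2)
          finally show ?case using monoD[OF mono] \<rho> by (meson less_le_trans)
        qed
      qed
    qed
    then show ?thesis
    proof eventually_elim
      case (elim n)
      obtain f where "f \<in> fst (\<theta> (r n))"
          "loss \<psi> (\<theta> (r n)) x = \<psi> (norm (transpose (snd (\<theta> (r n))) *v x - f))"
        using loss_attained[OF \<theta>] .
      with elim v[of "r n"] T show ?case by auto
    qed
  qed
  \<comment> \<open>Fatou's lemma, with the pointwise bound on the limit inferior reduced to levels
    \<open>y\<close> strictly below \<open>g x\<close>, the form provided by
    \<open>lower\<close>.\<close>
  have integral_le: "(\<integral>\<^sup>+ x. ennreal (g x) \<partial>Q) \<le> c"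
    if "T \<ge> 0" and g: "\<And>x y. 0 \<le> y \<Longrightarrow> y < g x \<Longrightarrow> \<forall>\<^sub>F n in sequentially. y < min T (loss \<psi> (\<theta> (r n)) x)"
    for g :: "real^'p \<Rightarrow> real" and T
  proof -
    let ?h = "\<lambda>n x. ennreal (min T (loss \<psi> (\<theta> n) x))"
    have [measurable]: "loss \<psi> (\<theta> n) \<in> borel_measurable Q" for n
      using borel_measurable_loss[OF \<theta>] Q(2) by (simp cong: measurable_cong_sets)
    have "ennreal (g x) \<le> liminf (\<lambda>n. ?h (r n) x)" for x
      unfolding le_Liminf_iff
    proof (intro allI impI)
      fix y assume y: "y < ennreal (g x)"
      then obtain y' where y': "0 \<le> y'" "y = ennreal y'"
        by (cases y) auto
      with y have "y' < g x" by (simp add: ennreal_less_iff)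
      from g[OF y'(1) this] show "\<forall>\<^sub>F n in sequentially. y < ?h (r n) x"
        unfolding y'(2) by eventually_elim (simp add: ennreal_less_iff y'(1) del: min_less_iff_conj)
    qed
    then have "(\<integral>\<^sup>+ x. ennreal (g x) \<partial>Q) \<le> (\<integral>\<^sup>+ x. liminf (\<lambda>n. ?h (r n) x) \<partial>Q)"
      by (intro nn_integral_mono) auto
    also have "\<dots> \<le> liminf (\<lambda>n. \<integral>\<^sup>+ x. ?h (r n) x \<partial>Q)"
      by (rule nn_integral_liminf) measurable
    also have "\<dots> \<le> limsup (\<lambda>n. \<integral>\<^sup>+ x. ?h (r n) x \<partial>Q)"
      by (rule Liminf_le_Limsup) simp
    also have "\<dots> \<le> limsup (\<lambda>n. \<integral>\<^sup>+ x. ?h n x \<partial>Q)"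
      using limsup_subseq_mono[OF r, of "\<lambda>n. \<integral>\<^sup>+ x. ?h n x \<partial>Q"] by (simp add: comp_def)
    also have "\<dots> \<le> c" by (rule c[OF \<open>T \<ge> 0\<close>])
    finally show ?thesis .
  qed
  have "J \<noteq> {}"
  proof
    assume "J = {}"
    obtain \<rho> where \<rho>: "min_risk TYPE('q) \<psi> k Q < ennreal (\<psi> \<rho>)"
      using min_risk_less_distortion[OF Q k A fin nontrivial] by blast
    have "(\<integral>\<^sup>+ x. ennreal (\<psi> \<rho>) \<partial>Q) \<le> c"
    \<comment> \<open>With all centres escaping, the loss eventually exceeds every level below
      \<open>\<psi> \<rho>\<close> at each point; here \<open>\<psi> \<rho>\<close> also serves as
      the truncation level.\<close>
    proof (rule integral_le[OF nonneg[of \<rho>]])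
      fix x y assume "y < \<psi> \<rho>"
      then show "\<forall>\<^sub>F n in sequentially. y < min (\<psi> \<rho>) (loss \<psi> (\<theta> (r n)) x)"
        using \<open>J = {}\<close> by (intro lower[OF _ _ \<open>y < \<psi> \<rho>\<close>]) auto
    qed
    then have "ennreal (\<psi> \<rho>) \<le> c"
      by (simp add: emeasure_space_1)
    with \<rho> c_le show False by (meson leD order_trans)
  qed
  define \<theta>' where "\<theta>' = (l ` J, A)"
  have \<theta>'_Xi: "\<theta>' \<in> Xi j" if "card (l ` J) \<le> j" for j
    using that A \<open>J \<noteq> {}\<close> J by (simp add: \<theta>'_def Xi_def center_sets_def)
  have card_le: "card (l ` J) \<le> card J" "card J \<le> k"
    using J card_image_le card_mono[OF _ J(2)] by auto
  then have \<theta>': "\<theta>' \<in> Xi k" by (intro \<theta>'_Xi) simp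
  have "(\<integral>\<^sup>+ x. ennreal (min (real T) (loss \<psi> \<theta>' x)) \<partial>Q) \<le> c" for T :: nat
  proof (rule integral_le[of T])
    fix x y assume y: "0 \<le> y" "y < min (real T) (loss \<psi> \<theta>' x)"
    obtain i0 where "i0 \<in> J" using \<open>J \<noteq> {}\<close> by blast
    have *: "y < \<psi> (norm (transpose A *v x - l i))" if "i \<in> J" for i
      using y(2) loss_le[OF \<theta>', of "l i" \<psi> x] that by (auto simp: \<theta>'_def)
    \<comment> \<open>The level required of the escaping centres is supplied by the surviving centre
      \<open>i0\<close>.\<close>
    show "\<forall>\<^sub>F n in sequentially. y < min (real T) (loss \<psi> (\<theta> (r n)) x)"
      using y(2) * by (intro lower[OF _ _ *[OF \<open>i0 \<in> J\<close>]]) auto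
  qed simp
  then have "(SUP T. \<integral>\<^sup>+ x. ennreal (min (real T) (loss \<psi> \<theta>' x)) \<partial>Q) \<le> c"
    by (rule SUP_least)
  also have "(SUP T. \<integral>\<^sup>+ x. ennreal (min (real T) (loss \<psi> \<theta>' x)) \<partial>Q)
      = (\<integral>\<^sup>+ x. (SUP T. ennreal (min (real T) (loss \<psi> \<theta>' x))) \<partial>Q)"
  proof (rule nn_integral_monotone_convergence_SUP[symmetric])
    have "loss \<psi> \<theta>' \<in> borel_measurable Q"
      using borel_measurable_loss[OF \<theta>'] Q(2) by (simp cong: measurable_cong_sets)
    then show "(\<lambda>x. ennreal (min (real T) (loss \<psi> \<theta>' x))) \<in> borel_measurable Q" for T :: nat
      by measurable
  qed (auto simp: incseq_def le_fun_def intro!: ennreal_leI)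
  finally have "(\<integral>\<^sup>+ x. (SUP T. ennreal (min (real T) (loss \<psi> \<theta>' x))) \<partial>Q) \<le> c" .
  moreover have "ennreal (loss \<psi> \<theta>' x) \<le> (SUP T. ennreal (min (real T) (loss \<psi> \<theta>' x)))" for x
  proof -
    obtain T :: nat where "loss \<psi> \<theta>' x \<le> T" using real_arch_simple by blast
    then show ?thesis by (intro SUP_upper2[of T]) (auto simp: min_def)
  qed
  then have "Psi \<psi> \<theta>' Q \<le> (\<integral>\<^sup>+ x. (SUP T. ennreal (min (real T) (loss \<psi> \<theta>' x))) \<partial>Q)"
    unfolding Psi_eq_loss by (intro nn_integral_mono) auto
  ultimately have risk: "Psi \<psi> \<theta>' Q \<le> c" by (rule order_trans[rotated])
  \<comment> \<open>Distinct indices could share a limit, so the distinct limits are counted: fewer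
    than \<open>k\<close> of them would attain, with fewer centres, a risk that
    \<open>strict\<close> forbids.\<close>
  have "card (l ` J) \<ge> k"
  proof (rule ccontr)
    assume "\<not> ?thesis"
    then have "min_risk TYPE('q) \<psi> k Q < min_risk TYPE('q) \<psi> (card (l ` J)) Q"
      using \<open>J \<noteq> {}\<close> J by (intro strict) (auto simp: Suc_le_eq card_gt_0_iff)
    also have "\<dots> \<le> Psi \<psi> \<theta>' Q" by (intro min_risk_le \<theta>'_Xi) simp
    finally show False using risk c_le by (meson leD order_trans)
  qed
  with card_le have "J = {..<k}"
    using J by (intro card_subset_eq) auto
  have "(\<lambda>n. param_dist (\<theta> (r n)) \<theta>') \<longlonglongrightarrow> 0"
  proof (rule tendsto_sandwich[OF _ _ tendsto_const])
    have "param_dist (\<theta> (r n)) \<theta>' \<le> dist (snd (\<theta> (r n))) A + (\<Sum>i<k. dist (v (r n) i) (l i))" for n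
    proof -
      have "param_dist (\<theta> (r n)) \<theta>' = param_dist (fst (\<theta> (r n)), snd (\<theta> (r n))) (l ` J, A)"
        by (simp add: \<theta>'_def)
      also have "\<dots> \<le> dist (snd (\<theta> (r n))) A + hausdorff_dist (fst (\<theta> (r n))) (l ` J)"
        using XiD[OF \<theta>, of "r n"] J \<open>J \<noteq> {}\<close> by (intro param_dist_le) auto
      also have "hausdorff_dist (fst (\<theta> (r n))) (l ` J) \<le> (\<Sum>i<k. dist (v (r n) i) (l i))"
        unfolding v \<open>J = {..<k}\<close> using k by (intro hausdorff_dist_image_le) simp
      finally show ?thesis by simp
    qed
    then show "\<forall>\<^sub>F n in sequentially. param_dist (\<theta> (r n)) \<theta>' \<le> dist (snd (\<theta> (r n))) A + (\<Sum>i<k. dist (v (r n) i) (l i))"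
      by simp
    have "(\<lambda>n. dist (snd (\<theta> (r n))) A + (\<Sum>i<k. dist (v (r n) i) (l i))) \<longlonglongrightarrow> dist A A + (\<Sum>i<k. dist (l i) (l i))"
      using l \<open>J = {..<k}\<close> by (intro tendsto_intros A_lim) auto
    then show "(\<lambda>n. dist (snd (\<theta> (r n))) A + (\<Sum>i<k. dist (v (r n) i) (l i))) \<longlonglongrightarrow> 0" by simp
  qed (simp add: param_dist_nonneg)
  with r \<theta>' risk show ?thesis by blast
qed

end

subsection \<open>Consistency\<close>

context distortion
begin

lemma borel_measurable_loss_cong:
  "\<theta> \<in> Xi k \<Longrightarrow> sets Q = sets borel \<Longrightarrow> loss \<psi> \<theta> \<in> borel_measurable Q"
  using borel_measurable_loss by (simp cong: measurable_cong_sets)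

lemma nn_integral_truncated_loss_le_Psi:
  "(\<integral>\<^sup>+ x. ennreal (min T (loss \<psi> \<theta> x)) \<partial>Q) \<le> Psi \<psi> \<theta> Q"
  unfolding Psi_eq_loss by (intro nn_integral_mono ennreal_leI) simp

text \<open>The direct method: a minimizing sequence satisfies the compactness lemma with
  \<open>c\<close> equal to the minimal risk, so its limit is a minimizer.\<close>

lemma optimal_params_nonempty:
  fixes Q :: "(real^'p) measure"
  assumes Q: "prob_space Q" "sets Q = sets borel"
    and k: "k \<ge> 1" and ne: "(Xi k :: ('q, 'p) param set) \<noteq> {}"
    and fin: "(\<integral>\<^sup>+ x. ennreal (\<psi> (norm x)) \<partial>Q) < \<infinity>"
    and nontrivial: "\<psi> s \<noteq> 0"
    and strict: "\<And>j. 1 \<le> j \<Longrightarrow> j < k \<Longrightarrow> min_risk TYPE('q) \<psi> j Q > min_risk TYPE('q) \<psi> k Q"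
  shows "(optimal_params \<psi> k Q :: ('q::finite, 'p::finite) param set) \<noteq> {}"
proof -
  obtain f where f: "decseq f" "range f \<subseteq> (\<lambda>\<theta> :: ('q, 'p) param. Psi \<psi> \<theta> Q) ` Xi k"
      "min_risk TYPE('q) \<psi> k Q = (INF i. f i)"
    unfolding min_risk_def
    using ennreal_Inf_countable_INF[of "(\<lambda>\<theta> :: ('q, 'p) param. Psi \<psi> \<theta> Q) ` Xi k"] ne by auto
  from f(2) have "\<forall>n. \<exists>\<theta>. \<theta> \<in> (Xi k :: ('q, 'p) param set) \<and> f n = Psi \<psi> \<theta> Q"
    by blast
  from choice[OF this] obtain \<theta> where
      \<theta>: "\<And>n. \<theta> n \<in> (Xi k :: ('q, 'p) param set)" "\<And>n. f n = Psi \<psi> (\<theta> n) Q"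
    by blast
  have "limsup (\<lambda>n. \<integral>\<^sup>+ x. ennreal (min T (loss \<psi> (\<theta> n) x)) \<partial>Q) \<le> min_risk TYPE('q) \<psi> k Q" for T
  proof -
    have "limsup (\<lambda>n. \<integral>\<^sup>+ x. ennreal (min T (loss \<psi> (\<theta> n) x)) \<partial>Q) \<le> limsup f"
      by (intro Limsup_mono always_eventually allI) (simp add: \<theta>(2) nn_integral_truncated_loss_le_Psi)
    also have "limsup f = min_risk TYPE('q) \<psi> k Q"
      unfolding f(3) by (intro lim_imp_Limsup LIMSEQ_INF f(1)) simp
    finally show ?thesis .
  qed
  from subsequence_converges_to_low_risk[OF Q k \<theta>(1) fin nontrivial strict this order_refl]
  obtain \<eta> :: "('q, 'p) param" where "\<eta> \<in> Xi k" "Psi \<psi> \<eta> Q \<le> min_risk TYPE('q) \<psi> k Q"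
    by blast
  with min_risk_le[of \<eta> k \<psi> Q] have "\<eta> \<in> optimal_params \<psi> k Q"
    by (auto simp: optimal_params_def intro: antisym)
  then show ?thesis by blast
qed

text \<open>A deterministic statement for one realization of the sample: randomness will enter only
  through \<open>lim\<close> and the bound at \<open>\<theta>\<^sub>0\<close>. Both conclusions
  follow by passing to subsequences.\<close>

lemma consistency_of_minimizers:
  fixes N :: "nat \<Rightarrow> (real^'p) measure" and Q :: "(real^'p) measure"
    and \<theta> :: "nat \<Rightarrow> ('q::finite, 'p::finite) param"
    and B :: "nat \<Rightarrow> nat \<Rightarrow> (real^'p) set"
  assumes Q: "prob_space Q" "sets Q = sets borel"
    and N: "\<And>n. n \<ge> 1 \<Longrightarrow> prob_space (N n)" "\<And>n. n \<ge> 1 \<Longrightarrow> sets (N n) = sets borel"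
    and B: "\<And>m j. B m j \<in> sets borel" "\<And>m. disjoint_family (B m)" "\<And>m. (\<Union>j. B m j) = UNIV"
      "\<And>m j x y. x \<in> B m j \<Longrightarrow> y \<in> B m j \<Longrightarrow> dist x y < inverse (Suc m)"
    and lim: "\<And>m j. (\<lambda>n. measure (N n) (B m j)) \<longlonglongrightarrow> measure Q (B m j)"
    and \<theta>: "\<And>n. n \<ge> 1 \<Longrightarrow> \<theta> n \<in> optimal_params \<psi> k (N n)"
    and \<theta>\<^sub>0: "\<theta>\<^sub>0 \<in> (optimal_params \<psi> k Q :: ('q, 'p) param set)"
      "limsup (\<lambda>n. Psi \<psi> \<theta>\<^sub>0 (N n)) \<le> Psi \<psi> \<theta>\<^sub>0 Q"
    and k: "k \<ge> 1"
    and fin: "(\<integral>\<^sup>+ x. ennreal (\<psi> (norm x)) \<partial>Q) < \<infinity>"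
    and nontrivial: "\<psi> s \<noteq> 0"
    and strict: "\<And>j. 1 \<le> j \<Longrightarrow> j < k \<Longrightarrow> min_risk TYPE('q) \<psi> j Q > min_risk TYPE('q) \<psi> k Q"
  shows "(\<lambda>n. param_setdist (\<theta> n) (optimal_params \<psi> k Q)) \<longlonglongrightarrow> 0"
    and "(\<lambda>n. min_risk TYPE('q) \<psi> k (N n)) \<longlonglongrightarrow> min_risk TYPE('q) \<psi> k Q"
proof -
  define u where "u n = min_risk TYPE('q) \<psi> k (N n)" for n
  define m where "m = min_risk TYPE('q) \<psi> k Q"
  \<comment> \<open>\<open>\<theta> 0\<close> is unconstrained; replacing it by
    \<open>\<theta>\<^sub>0\<close> makes every term admissible without affecting limits.\<close>
  define \<eta> where "\<eta> n = (if n \<ge> 1 then \<theta> n else \<theta>\<^sub>0)" for n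
  have \<theta>\<^sub>0_Xi: "\<theta>\<^sub>0 \<in> Xi k" using \<theta>\<^sub>0 by (simp add: optimal_params_def)
  have \<eta>: "\<eta> n \<in> Xi k" for n using \<theta> \<theta>\<^sub>0_Xi by (simp add: \<eta>_def optimal_params_def)
  have "limsup u \<le> limsup (\<lambda>n. Psi \<psi> \<theta>\<^sub>0 (N n))"
    unfolding u_def by (intro Limsup_mono always_eventually allI min_risk_le \<theta>\<^sub>0_Xi)
  also have "\<dots> \<le> m" using \<theta>\<^sub>0 by (simp add: optimal_params_def m_def)
  finally have limsup_u: "limsup u \<le> m" .
  let ?w = "\<lambda>T n. \<integral>\<^sup>+ x. ennreal (min T (loss \<psi> (\<eta> n) x)) \<partial>Q"
  \<comment> \<open>The comparison is uniform over all parameters, so it applies to the varying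
    minimizers.\<close>
  have w_le: "\<forall>\<^sub>F n in sequentially. ?w T n \<le> ennreal e + u n" if T: "T \<ge> 0" and e: "e > 0" for T e
  proof -
    let ?H = "(\<lambda>\<theta> x. min T (loss \<psi> \<theta> x)) ` (Xi k :: ('q, 'p) param set)"
    have "\<forall>\<^sub>F n in sequentially. \<forall>h\<in>?H. (\<integral>x. h x \<partial>Q) \<le> (\<integral>x. h x \<partial>N n) + e"
    proof (rule integral_le_equicontinuous[OF N Q B lim])
      show "h x \<in> {0..T + 1}" if "h \<in> ?H" for h x
        using that T loss_nonneg by (auto simp: min_le_iff_disj)
      show "\<exists>d>0. \<forall>h\<in>?H. \<forall>x y. dist x y < d \<longrightarrow> h x \<le> h y + \<epsilon>" if "\<epsilon> > 0" for \<epsilon>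
        using truncated_loss_equicontinuous[OF T that, of k, where 'q = 'q and 'p = 'p] by blast
    qed (use T e in auto)
    with eventually_ge_at_top[of 1] show ?thesis
    proof eventually_elim
      case (elim n)
      let ?h = "\<lambda>x. min T (loss \<psi> (\<eta> n) x)"
      have h: "0 \<le> ?h x" "?h x \<le> T" for x using T loss_nonneg[OF \<eta>] by auto
      have nn: "(\<integral>\<^sup>+ x. ennreal (?h x) \<partial>R) = ennreal (\<integral>x. ?h x \<partial>R)"
        if "prob_space R" "sets R = sets borel" for R
      proof (rule nn_integral_eq_integral)
        interpret prob_space R by fact
        note [measurable] = borel_measurable_loss_cong[OF \<eta> that(2)]
        show "integrable R ?h"
          by (rule integrable_const_bound[of _ T]) (use h in auto)
      qed (use h in auto)
      have "?w T n \<le> ennreal ((\<integral>x. ?h x \<partial>N n) + e)"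
        unfolding nn[OF Q] using elim(2) \<eta> by (intro ennreal_leI) blast
      also have "\<dots> = ennreal e + (\<integral>\<^sup>+ x. ennreal (?h x) \<partial>N n)"
        using e h unfolding nn[OF N[OF elim(1)]]
        by (subst ennreal_plus) (auto intro!: Bochner_Integration.integral_nonneg simp: add.commute)
      also have "\<dots> \<le> ennreal e + Psi \<psi> (\<eta> n) (N n)"
        by (intro add_left_mono nn_integral_truncated_loss_le_Psi)
      also have "Psi \<psi> (\<eta> n) (N n) = u n"
        using \<theta>[OF elim(1)] elim(1) by (simp add: u_def \<eta>_def optimal_params_def)
      finally show ?case .
    qed
  qed
  \<comment> \<open>Compactness is applied with \<open>c\<close> the limit superior of the empirical
    optima along \<open>r\<close>. The limit parameter has risk between \<open>m\<close> and
    \<open>c\<close>, and \<open>c \<le> m\<close>, so it is optimal.\<close>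
  have sub: "\<exists>s \<eta>'. strict_mono s \<and> \<eta>' \<in> optimal_params \<psi> k Q \<and> m \<le> limsup (\<lambda>n. u (r n)) \<and>
      (\<lambda>n. param_dist (\<eta> (r (s n))) \<eta>') \<longlonglongrightarrow> 0" if r: "strict_mono r" for r
  proof -
    have "limsup (\<lambda>n. ?w T (r n)) \<le> limsup (\<lambda>n. u (r n))" if T: "T \<ge> 0" for T
    proof (rule ennreal_le_epsilon)
      fix e :: real assume "0 < e"
      have "limsup (\<lambda>n. ?w T (r n)) \<le> limsup (\<lambda>n. ennreal e + u (r n))"
        by (intro Limsup_mono eventually_subseq[OF r w_le[OF T \<open>0 < e\<close>]])
      also have "\<dots> = ennreal e + limsup (\<lambda>n. u (r n))"
        by (rule Limsup_const_add) simp
      finally show "limsup (\<lambda>n. ?w T (r n)) \<le> limsup (\<lambda>n. u (r n)) + ennreal e"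
        by (simp add: add.commute)
    qed
    moreover have limsup_le: "limsup (\<lambda>n. u (r n)) \<le> m"
      using limsup_subseq_mono[OF r, of u] limsup_u by (simp add: comp_def)
    ultimately obtain s \<eta>' where *: "strict_mono s" "\<eta>' \<in> Xi k"
        "Psi \<psi> \<eta>' Q \<le> limsup (\<lambda>n. u (r n))" "(\<lambda>n. param_dist (\<eta> (r (s n))) \<eta>') \<longlonglongrightarrow> 0"
      using subsequence_converges_to_low_risk[where \<theta> = "\<lambda>n. \<eta> (r n)" and c = "limsup (\<lambda>n. u (r n))",
          OF Q k \<eta> fin nontrivial strict]
      unfolding m_def by blast
    moreover have "m \<le> Psi \<psi> \<eta>' Q" unfolding m_def by (rule min_risk_le) fact
    ultimately show ?thesis
      using limsup_le by (intro exI[of _ s] exI[of _ \<eta>']) (auto simp: optimal_params_def m_def)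
  qed
  \<comment> \<open>Along a subsequence realizing the limit inferior, the limit superior in
    \<open>sub\<close> equals \<open>liminf u\<close>, which gives the missing lower bound.\<close>
  obtain r where r: "strict_mono r" "(u \<circ> r) \<longlonglongrightarrow> liminf u"
    using liminf_subseq_lim[of u] by blast
  have "m \<le> limsup (\<lambda>n. u (r n))" using sub[OF r(1)] by blast
  also have "\<dots> = liminf u"
    using lim_imp_Limsup[OF _ r(2)] by (simp add: comp_def)
  finally have "m \<le> liminf u" .
  with limsup_u Liminf_le_Limsup[of sequentially u] show "u \<longlonglongrightarrow> m"
    unfolding tendsto_iff_Liminf_eq_Limsup[OF trivial_limit_sequentially] by (auto intro: antisym)
  show "(\<lambda>n. param_setdist (\<theta> n) (optimal_params \<psi> k Q)) \<longlonglongrightarrow> 0"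
  proof (rule ccontr)
    assume "\<not> ?thesis"
    then obtain e where "e > 0" and "\<not> (\<forall>\<^sub>F n in sequentially. dist (param_setdist (\<theta> n) (optimal_params \<psi> k Q)) 0 < e)"
      unfolding tendsto_iff by blast
    from not_eventually_sequentiallyD[OF this(2)] obtain r :: "nat \<Rightarrow> nat" where r: "strict_mono r"
        "\<And>n. \<not> dist (param_setdist (\<theta> (r n)) (optimal_params \<psi> k Q)) 0 < e"
      by blast
    obtain s \<eta>' where s: "strict_mono s" "\<eta>' \<in> optimal_params \<psi> k Q"
        "(\<lambda>n. param_dist (\<eta> (r (s n))) \<eta>') \<longlonglongrightarrow> 0"
      using sub[OF r(1)] by blast
    have "\<forall>\<^sub>F n in sequentially. param_dist (\<eta> (r (s n))) \<eta>' < e"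
      using s(3) \<open>e > 0\<close> by (rule order_tendstoD)
    moreover have "\<forall>\<^sub>F n in sequentially. r (s n) \<ge> 1"
      using eventually_subseq[OF s(1) eventually_subseq[OF r(1) eventually_ge_at_top[of 1]]] .
    ultimately have "\<forall>\<^sub>F n in sequentially. False"
    proof eventually_elim
      case (elim n)
      have "param_setdist (\<theta> (r (s n))) (optimal_params \<psi> k Q) \<le> param_dist (\<theta> (r (s n))) \<eta>'"
        by (rule param_setdist_le[OF s(2)])
      also have "\<dots> < e" using elim by (simp add: \<eta>_def)
      finally have "param_setdist (\<theta> (r (s n))) (optimal_params \<psi> k Q) < e" .
      moreover have "0 \<le> param_setdist (\<theta> (r (s n))) (optimal_params \<psi> k Q)"
        using s(2) by (intro param_setdist_nonneg) blast
      ultimately show False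
        using r(2)[of "s n"] by (simp add: dist_real_def)
    qed
    then show False by simp
  qed
qed

end

theorem theorem1:
  fixes M :: "'a measure"
    and P :: "(real^'p) measure"
    and X :: "nat \<Rightarrow> 'a \<Rightarrow> real^'p"
    and \<psi> :: "real \<Rightarrow> real"
    and k :: nat
    and \<theta>hat :: "nat \<Rightarrow> 'a \<Rightarrow> ('q::finite, 'p::finite) param"
  assumes "CARD('q) < CARD('p)" and "k \<ge> 1"
    and "prob_space P" and "sets P = sets borel"
    and "prob_space M"
    and "prob_space.indep_vars M (\<lambda>_. borel) X UNIV"
    and "\<And>i. distr M borel (X i) = P"
    and "\<And>r. \<psi> r \<ge> 0" and "mono \<psi>" and "continuous_on UNIV \<psi>" and "\<psi> 0 = 0"
    and "\<exists>c>0. \<forall>r>0. \<psi> (2 * r) \<le> c * \<psi> r"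
    and "\<And>n. n \<ge> 1 \<Longrightarrow> \<theta>hat n \<in> measurable M (Xi_borel k)"
    and "\<And>n \<omega>. n \<ge> 1 \<Longrightarrow> \<omega> \<in> space M \<Longrightarrow>
           \<theta>hat n \<omega> \<in> optimal_params \<psi> k (empirical_measure n (\<lambda>i. X i \<omega>))"
    and "(\<integral>\<^sup>+ x. ennreal (\<psi> (norm x)) \<partial>P) < \<infinity>"
    and "\<And>j. 1 \<le> j \<Longrightarrow> j < k \<Longrightarrow> min_risk TYPE('q) \<psi> j P > min_risk TYPE('q) \<psi> k P"
  shows "(optimal_params \<psi> k P :: ('q, 'p) param set) \<noteq> {}
    \<and> (AE \<omega> in M. (\<lambda>n. param_setdist (\<theta>hat n \<omega>) (optimal_params \<psi> k P)) \<longlonglongrightarrow> 0)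
    \<and> (AE \<omega> in M. (\<lambda>n. min_risk TYPE('q) \<psi> k (empirical_measure n (\<lambda>i. X i \<omega>)))
          \<longlonglongrightarrow> min_risk TYPE('q) \<psi> k P)"
proof -
  interpret M: prob_space M by fact
  interpret distortion \<psi> by unfold_locales fact+
  have Xi: "\<theta>hat n \<omega> \<in> Xi k" if "n \<ge> 1" "\<omega> \<in> space M" for n \<omega>
    using assms(14)[OF that] by (simp add: optimal_params_def)
  \<comment> \<open>Admissible parameters exist because the estimator takes values among
    them.\<close>
  have ne: "(Xi k :: ('q, 'p) param set) \<noteq> {}"
    using Xi[of 1] M.not_empty by blast
  show ?thesis
  proof (cases "\<exists>s. \<psi> s \<noteq> 0")
    \<comment> \<open>If \<open>\<psi>\<close> vanishes identically, all risks are 0 and every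
      admissible parameter is optimal.\<close>
    case False
    have Psi_0: "Psi \<psi> \<theta> Q = 0" if "\<theta> \<in> Xi k" for \<theta> :: "('q, 'p) param" and Q
    proof -
      have "loss \<psi> \<theta> x = 0" for x
        using loss_attained[OF that, of \<psi> x] False by metis
      then show ?thesis by (simp add: Psi_eq_loss)
    qed
    have min_risk_0: "min_risk TYPE('q) \<psi> k Q = 0" for Q :: "(real^'p) measure"
      using ne Psi_0 unfolding min_risk_def by (simp cong: INF_cong_simp)
    have opt: "optimal_params \<psi> k P = (Xi k :: ('q, 'p) param set)"
      by (auto simp: optimal_params_def Psi_0 min_risk_0)
    have "param_setdist (\<theta>hat n \<omega>) (Xi k) = 0" if "n \<ge> 1" "\<omega> \<in> space M" for n \<omega>
    proof (rule antisym)
      have "param_dist (\<theta>hat n \<omega>) (\<theta>hat n \<omega>) = 0"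
        using Metric_space.mdist_zero[OF Metric_space_param_dist Xi[OF that]] .
      then show "param_setdist (\<theta>hat n \<omega>) (Xi k) \<le> 0"
        using param_setdist_le[OF Xi[OF that], of "\<theta>hat n \<omega>"] by simp
    qed (rule param_setdist_nonneg[OF ne])
    then have "(\<lambda>n. param_setdist (\<theta>hat n \<omega>) (Xi k)) \<longlonglongrightarrow> 0" if "\<omega> \<in> space M" for \<omega>
      using that by (intro tendsto_eventually eventually_sequentiallyI[of 1]) auto
    then show ?thesis
      unfolding opt min_risk_0 using ne by auto
  next
    case True
    then obtain s where s: "\<psi> s \<noteq> 0" by blast
    have opt: "(optimal_params \<psi> k P :: ('q, 'p) param set) \<noteq> {}"
      using optimal_params_nonempty[OF assms(3,4,2) ne assms(15) s assms(16)] .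
    then obtain \<theta>\<^sub>0 :: "('q, 'p) param" where \<theta>\<^sub>0: "\<theta>\<^sub>0 \<in> optimal_params \<psi> k P" by blast
    then have \<theta>\<^sub>0_Xi: "\<theta>\<^sub>0 \<in> Xi k" by (simp add: optimal_params_def)
    \<comment> \<open>The partitions are fixed independently of the sample, so only countably many
      almost sure convergences have to hold simultaneously.\<close>
    have "\<exists>B :: nat \<Rightarrow> (real^'p) set. (\<forall>j. B j \<in> sets borel) \<and> disjoint_family B \<and> (\<Union>j. B j) = UNIV \<and>
        (\<forall>j x y. x \<in> B j \<longrightarrow> y \<in> B j \<longrightarrow> dist x y < inverse (Suc m))" for m
      using small_cells[of "inverse (Suc m)", where 'b = "real^'p"] by (metis inverse_positive_iff_positive of_nat_0_less_iff zero_less_Suc)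
    then obtain B :: "nat \<Rightarrow> nat \<Rightarrow> (real^'p) set" where B: "\<And>m j. B m j \<in> sets borel"
        "\<And>m. disjoint_family (B m)" "\<And>m. (\<Union>j. B m j) = UNIV"
        "\<And>m j x y. x \<in> B m j \<Longrightarrow> y \<in> B m j \<Longrightarrow> dist x y < inverse (Suc m)"
      by metis
    have "AE \<omega> in M. \<forall>m j. (\<lambda>n. measure (empirical_measure n (\<lambda>i. X i \<omega>)) (B m j)) \<longlonglongrightarrow> measure P (B m j)"
      using M.empirical_measure_tendsto[OF assms(6,7) B(1)] by (simp add: AE_all_countable)
    moreover have "AE \<omega> in M. limsup (\<lambda>n. Psi \<psi> \<theta>\<^sub>0 (empirical_measure n (\<lambda>i. X i \<omega>))) \<le> Psi \<psi> \<theta>\<^sub>0 P"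
      unfolding Psi_eq_loss
      by (rule M.limsup_nn_integral_empirical_measure_le[OF assms(6,7) borel_measurable_loss[OF \<theta>\<^sub>0_Xi] loss_nonneg[OF \<theta>\<^sub>0_Xi]])
    ultimately have "AE \<omega> in M. (\<lambda>n. param_setdist (\<theta>hat n \<omega>) (optimal_params \<psi> k P)) \<longlonglongrightarrow> 0 \<and>
        (\<lambda>n. min_risk TYPE('q) \<psi> k (empirical_measure n (\<lambda>i. X i \<omega>))) \<longlonglongrightarrow> min_risk TYPE('q) \<psi> k P"
      using AE_space
    proof eventually_elim
      case (elim \<omega>)
      note consistency = consistency_of_minimizers[OF assms(3,4) prob_space_empirical_measure sets_empirical_measure
          B _ assms(14) \<theta>\<^sub>0 elim(2) assms(2,15) s assms(16)]
      show ?case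
        using elim by (intro conjI consistency) auto
    qed
    then show ?thesis using opt by (auto simp: AE_conj_iff)
  qed
qed

end
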